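(* For every sequence $(\varepsilon_n)_{n \geq 1}$ of positive numbers tending to $0$, there exists an analytic map $\varphi \colon \mathbb{D} \to \mathbb{D}$ such that the composition operator $C_\varphi \colon f \mapsto f \circ \varphi$ is a compact operator on the Dirichlet space $\mathcal{D}$ and $$\liminf_{n\to \infty} \frac{a_{n} (C_\varphi)}{\varepsilon_n} > 0 ,$$ where $a_n(C_\varphi)$ is the $n$-th approximation number of $C_\varphi \colon \mathcal{D} \to \mathcal{D}$.
   Context: $\mathbb{D}$ is the open unit disk of $\mathbb{C}$ and $dA = dx\,dy/\pi$ is the normalized area measure on $\mathbb{D}$. The Dirichlet space $\mathcal{D}$ is the Hilbert space of analytic functions $f \colon \mathbb{D} \to \mathbb{C}$ such that $\|f\|_{\mathcal{D}}^2 := |f(0)|^2 + \int_{\mathbb{D}} |f'(z)|^2 \, dA(z) < +\infty$. For a bounded linear operator $T \colon H \to H$ on a Hilbert space $H$, the $n$-th approximation number is $a_n(T) = \inf\{\|T - R\| : \operatorname{rank} R < n\}$, $n = 1, 2, \ldots$ *)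

theory Defs
  imports "HOL-Complex_Analysis.Complex_Analysis" "HOL-Library.Extended_Nat"
begin

abbreviation unit_disk :: "complex set" where
  "unit_disk \<equiv> ball 0 1"

text \<open>
  A function on the disk is represented by its extension by zero to the whole plane, so that
  equality of elements of the Dirichlet space is equality of functions on the disk.
\<close>

definition dirichlet_set :: "(complex \<Rightarrow> complex) set" where
  "dirichlet_set = {f. f holomorphic_on unit_disk \<and> (\<forall>z. z \<notin> unit_disk \<longrightarrow> f z = 0) \<and>
     set_integrable lborel unit_disk (\<lambda>z. (cmod (deriv f z))\<^sup>2)}"

lemma deriv_set_measurable:
  assumes "f holomorphic_on unit_disk"
  shows "(\<lambda>z. indicator unit_disk z *\<^sub>R deriv f z) \<in> borel_measurable lborel"
proof -
  have "continuous_on unit_disk (deriv f)"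
    using assms by (intro holomorphic_on_imp_continuous_on holomorphic_deriv) auto
  then show ?thesis
    using borel_measurable_continuous_on_indicator[of unit_disk "deriv f"] by simp
qed

lemma dirichlet_inner_integrable:
  assumes "f \<in> dirichlet_set" "g \<in> dirichlet_set"
  shows "set_integrable lborel unit_disk (\<lambda>z. inner (deriv f z) (deriv g z))"
proof -
  let ?I = "\<lambda>z. indicator unit_disk z :: real"
  have m: "(\<lambda>z. inner (?I z *\<^sub>R deriv f z) (?I z *\<^sub>R deriv g z)) \<in> borel_measurable lborel"
    using assms unfolding dirichlet_set_def
    by (intro borel_measurable_inner deriv_set_measurable) auto
  have eq: "(\<lambda>z. inner (?I z *\<^sub>R deriv f z) (?I z *\<^sub>R deriv g z)) =
            (\<lambda>z. ?I z *\<^sub>R inner (deriv f z) (deriv g z))"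
    by (auto simp: indicator_def)
  have i: "integrable lborel (\<lambda>z. ?I z *\<^sub>R (cmod (deriv f z))\<^sup>2 + ?I z *\<^sub>R (cmod (deriv g z))\<^sup>2)"
    using assms unfolding dirichlet_set_def set_integrable_def
    by (intro Bochner_Integration.integrable_add) auto
  have b: "\<bar>inner a b\<bar> \<le> (cmod a)\<^sup>2 + (cmod b)\<^sup>2" for a b :: complex
  proof -
    have "\<bar>inner a b\<bar> \<le> cmod a * cmod b" by (rule Cauchy_Schwarz_ineq2)
    also have "2 * (cmod a * cmod b) \<le> (cmod a)\<^sup>2 + (cmod b)\<^sup>2"
      using sum_squares_bound[of "cmod a" "cmod b"] by simp
    then have "cmod a * cmod b \<le> (cmod a)\<^sup>2 + (cmod b)\<^sup>2"
      using mult_nonneg_nonneg[OF norm_ge_zero[of a] norm_ge_zero[of b]] by linarith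
    finally show ?thesis .
  qed
  show ?thesis
    unfolding set_integrable_def
  proof (rule Bochner_Integration.integrable_bound[OF i])
    show "(\<lambda>z. ?I z *\<^sub>R inner (deriv f z) (deriv g z)) \<in> borel_measurable lborel"
      using m unfolding eq .
  qed (use b in \<open>auto simp: indicator_def\<close>)
qed

lemma dirichlet_deriv_add:
  assumes "f \<in> dirichlet_set" "g \<in> dirichlet_set" "z \<in> unit_disk"
  shows "deriv (\<lambda>z. f z + g z) z = deriv f z + deriv g z"
  using assms unfolding dirichlet_set_def
  by (intro deriv_add) (auto simp: holomorphic_on_open field_differentiable_def)

lemma dirichlet_deriv_scale:
  assumes "f \<in> dirichlet_set" "z \<in> unit_disk"
  shows "deriv (\<lambda>z. c * f z) z = c * deriv f z"
  using assms unfolding dirichlet_set_def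
  by (intro deriv_cmult) (auto simp: holomorphic_on_open field_differentiable_def)

lemma dirichlet_set_zero: "(\<lambda>_. 0) \<in> dirichlet_set"
  by (simp add: dirichlet_set_def set_integrable_def)

lemma dirichlet_set_add:
  assumes f: "f \<in> dirichlet_set" and g: "g \<in> dirichlet_set"
  shows "(\<lambda>z. f z + g z) \<in> dirichlet_set"
proof -
  have "set_integrable lborel unit_disk
      (\<lambda>z. inner (deriv f z) (deriv f z) + (inner (deriv f z) (deriv g z) +
           (inner (deriv f z) (deriv g z) + inner (deriv g z) (deriv g z))))"
    by (intro set_integral_add dirichlet_inner_integrable f g)
  then have "set_integrable lborel unit_disk (\<lambda>z. (cmod (deriv (\<lambda>z. f z + g z) z))\<^sup>2)"
    by (rule set_integrable_cong[THEN iffD1, rotated -1])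
       (auto simp: dirichlet_deriv_add[OF f g] dot_square_norm[symmetric] inner_add
          inner_commute)
  then show ?thesis
    using f g by (auto simp: dirichlet_set_def intro!: holomorphic_intros)
qed

lemma dirichlet_set_scale:
  assumes f: "f \<in> dirichlet_set"
  shows "(\<lambda>z. c * f z) \<in> dirichlet_set"
proof -
  have "set_integrable lborel unit_disk (\<lambda>z. (cmod c)\<^sup>2 * (cmod (deriv f z))\<^sup>2)"
    using f by (intro set_integrable_mult_right) (simp add: dirichlet_set_def)
  then have "set_integrable lborel unit_disk (\<lambda>z. (cmod (deriv (\<lambda>z. c * f z) z))\<^sup>2)"
    by (rule set_integrable_cong[THEN iffD1, rotated -1])
       (auto simp: dirichlet_deriv_scale[OF f] norm_mult power_mult_distrib)
  then show ?thesis
    using f by (auto simp: dirichlet_set_def intro!: holomorphic_intros)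
qed

typedef dirichlet = dirichlet_set
  morphisms dfun Abs_dirichlet
  using dirichlet_set_zero by blast

setup_lifting type_definition_dirichlet

lift_definition scaleC :: "complex \<Rightarrow> dirichlet \<Rightarrow> dirichlet" is "\<lambda>c f z. c * f z"
  by (rule dirichlet_set_scale)

instantiation dirichlet :: ab_group_add
begin
lift_definition zero_dirichlet :: dirichlet is "\<lambda>_. 0" by (rule dirichlet_set_zero)
lift_definition plus_dirichlet :: "dirichlet \<Rightarrow> dirichlet \<Rightarrow> dirichlet" is "\<lambda>f g z. f z + g z"
  by (rule dirichlet_set_add)
lift_definition uminus_dirichlet :: "dirichlet \<Rightarrow> dirichlet" is "\<lambda>f z. - f z"
  using dirichlet_set_scale[where c = "- 1"] by simp
lift_definition minus_dirichlet :: "dirichlet \<Rightarrow> dirichlet \<Rightarrow> dirichlet" is "\<lambda>f g z. f z - g z"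
  using dirichlet_set_add[OF _ dirichlet_set_scale[where c = "- 1"]] by simp
instance by standard (transfer; simp add: algebra_simps)+
end

global_interpretation dirichlet: vector_space scaleC
  by standard (transfer; simp add: algebra_simps)+

instantiation dirichlet :: real_vector
begin

definition scaleR_dirichlet :: "real \<Rightarrow> dirichlet \<Rightarrow> dirichlet" where
  "scaleR_dirichlet r f = scaleC (complex_of_real r) f"

instance
  by standard (simp_all add: scaleR_dirichlet_def dirichlet.scale_right_distrib
      dirichlet.scale_left_distrib)

end

instantiation dirichlet :: real_inner
begin

definition norm_dirichlet :: "dirichlet \<Rightarrow> real" where
  "norm_dirichlet f = sqrt ((cmod (dfun f 0))\<^sup>2 +
     (LINT z:unit_disk|lborel. (cmod (deriv (dfun f) z))\<^sup>2) / pi)"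

text \<open>
  This is the real part of the Hermitian inner product, as the class \<^class>\<open>real_inner\<close>
  requires; it induces the same norm.
\<close>

definition inner_dirichlet :: "dirichlet \<Rightarrow> dirichlet \<Rightarrow> real" where
  "inner_dirichlet f g = inner (dfun f 0) (dfun g 0) +
     (LINT z:unit_disk|lborel. inner (deriv (dfun f) z) (deriv (dfun g) z)) / pi"

definition dist_dirichlet :: "dirichlet \<Rightarrow> dirichlet \<Rightarrow> real" where
  "dist_dirichlet f g = norm (f - g)"

definition sgn_dirichlet :: "dirichlet \<Rightarrow> dirichlet" where
  "sgn_dirichlet f = inverse (norm f) *\<^sub>R f"

definition uniformity_dirichlet :: "(dirichlet \<times> dirichlet) filter" where
  "uniformity_dirichlet = (INF e\<in>{0<..}. principal {(x, y). dist x y < e})"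

definition open_dirichlet :: "dirichlet set \<Rightarrow> bool" where
  "open_dirichlet U \<longleftrightarrow> (\<forall>x\<in>U. \<forall>\<^sub>F (x', y) in uniformity. x' = x \<longrightarrow> y \<in> U)"

instance
proof
  fix x y z :: dirichlet and r :: real and U :: "dirichlet set"
  note D = dfun[of x] dfun[of y] dfun[of z]
  show "dist x y = norm (x - y)" by (rule dist_dirichlet_def)
  show "sgn x = x /\<^sub>R norm x" by (rule sgn_dirichlet_def)
  show "(uniformity :: (dirichlet \<times> dirichlet) filter) =
      (INF e\<in>{0<..}. principal {(x, y). dist x y < e})"
    by (rule uniformity_dirichlet_def)
  show "open U \<longleftrightarrow> (\<forall>x\<in>U. \<forall>\<^sub>F (x', y) in uniformity. x' = x \<longrightarrow> y \<in> U)"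
    by (rule open_dirichlet_def)
  show "inner x y = inner y x"
    by (simp add: inner_dirichlet_def inner_commute)
  have "(LINT w:unit_disk|lborel. inner (deriv (dfun (x + y)) w) (deriv (dfun z) w)) =
      (LINT w:unit_disk|lborel. inner (deriv (dfun x) w) (deriv (dfun z) w) +
        inner (deriv (dfun y) w) (deriv (dfun z) w))"
    by (intro set_lebesgue_integral_cong)
       (auto simp: plus_dirichlet.rep_eq dirichlet_deriv_add[OF D(1,2)] inner_add)
  also have "\<dots> = (LINT w:unit_disk|lborel. inner (deriv (dfun x) w) (deriv (dfun z) w)) +
        (LINT w:unit_disk|lborel. inner (deriv (dfun y) w) (deriv (dfun z) w))"
    by (intro set_integral_add dirichlet_inner_integrable D)
  finally show "inner (x + y) z = inner x z + inner y z"
    by (simp add: inner_dirichlet_def plus_dirichlet.rep_eq inner_add add_divide_distrib)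
  have sc: "inner (complex_of_real r * a) b = r * inner a b" for a b
    by (simp flip: scaleR_conv_of_real)
  have "(LINT w:unit_disk|lborel. inner (deriv (dfun (r *\<^sub>R x)) w) (deriv (dfun y) w)) =
      (LINT w:unit_disk|lborel. r * inner (deriv (dfun x) w) (deriv (dfun y) w))"
    by (intro set_lebesgue_integral_cong)
       (auto simp: scaleR_dirichlet_def scaleC.rep_eq dirichlet_deriv_scale[OF D(1)] sc)
  then show "inner (r *\<^sub>R x) y = r * inner x y"
    by (simp add: inner_dirichlet_def scaleR_dirichlet_def scaleC.rep_eq sc distrib_left)
  have nn: "0 \<le> (LINT w:unit_disk|lborel. inner (deriv (dfun x) w) (deriv (dfun x) w))"
    unfolding set_lebesgue_integral_def by (intro integral_nonneg_AE) auto
  then show "0 \<le> inner x x"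
    by (simp add: inner_dirichlet_def)
  show "norm x = sqrt (inner x x)"
    by (simp add: norm_dirichlet_def inner_dirichlet_def dot_square_norm)
  show "inner x x = 0 \<longleftrightarrow> x = 0"
  proof
    assume "x = 0"
    then show "inner x x = 0"
      by (simp add: inner_dirichlet_def zero_dirichlet.rep_eq)
  next
    assume 0: "inner x x = 0"
    let ?f = "dfun x"
    have hol: "?f holomorphic_on unit_disk" and out: "\<And>z. z \<notin> unit_disk \<Longrightarrow> ?f z = 0"
      using D(1) by (auto simp: dirichlet_set_def)
    have "0 \<le> (LINT w:unit_disk|lborel. inner (deriv ?f w) (deriv ?f w)) / pi"
      using nn by simp
    then have f0: "?f 0 = 0"
      and I0: "(LINT w:unit_disk|lborel. inner (deriv ?f w) (deriv ?f w)) = 0"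
      using 0 inner_ge_zero[of "?f 0"] unfolding inner_dirichlet_def
      by (simp_all add: add_nonneg_eq_0_iff)
    have "AE w in lborel. indicator unit_disk w *\<^sub>R inner (deriv ?f w) (deriv ?f w) = 0"
      using I0 dirichlet_inner_integrable[OF D(1) D(1)]
      unfolding set_lebesgue_integral_def set_integrable_def
      by (subst (asm) integral_nonneg_eq_0_iff_AE) auto
    then have ae: "AE w in lborel. w \<in> unit_disk \<longrightarrow> deriv ?f w = 0"
      by eventually_elim (auto simp: indicator_def)
    have d0: "deriv ?f w = 0" if w: "w \<in> unit_disk" for w
    proof (rule ccontr)
      assume nz: "deriv ?f w \<noteq> 0"
      have "continuous_on unit_disk (deriv ?f)"
        using hol by (intro holomorphic_on_imp_continuous_on holomorphic_deriv) auto
      then have op: "open (unit_disk \<inter> deriv ?f -` (- {0}))"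
        by (intro continuous_open_preimage) auto
      have "AE w in lborel. w \<notin> unit_disk \<inter> deriv ?f -` (- {0})"
        using ae by eventually_elim auto
      then have "unit_disk \<inter> deriv ?f -` (- {0}) \<in> null_sets lborel"
        using op by (subst AE_iff_null_sets) auto
      then have "negligible (unit_disk \<inter> deriv ?f -` (- {0}))"
        by (simp only: negligible_iff_null_sets null_sets_completionI)
      moreover have "unit_disk \<inter> deriv ?f -` (- {0}) \<noteq> {}"
        using w nz by blast
      ultimately show False
        using open_not_negligible[OF op] by blast
    qed
    have "(?f has_field_derivative 0) (at w within unit_disk)" if "w \<in> unit_disk" for w
      using holomorphic_derivI[OF hol open_ball that] d0[OF that]
      by (simp add: has_field_derivative_at_within)
    then obtain c where c: "\<And>z. z \<in> unit_disk \<Longrightarrow> ?f z = c"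
      using has_field_derivative_zero_constant[of unit_disk ?f] convex_ball by blast
    have "?f z = 0" for z
      using c[of z] c[of 0] f0 out[of z] by (cases "z \<in> unit_disk") simp_all
    then have "?f = dfun 0"
      by (simp add: zero_dirichlet.rep_eq fun_eq_iff)
    then show "x = 0"
      by (simp only: dfun_inject)
  qed
qed

end

abbreviation clinear_op :: "(dirichlet \<Rightarrow> dirichlet) \<Rightarrow> bool" where
  "clinear_op \<equiv> Vector_Spaces.linear scaleC scaleC"

definition bounded_op :: "(dirichlet \<Rightarrow> dirichlet) \<Rightarrow> bool" where
  "bounded_op T \<longleftrightarrow> clinear_op T \<and> bounded_linear T"

definition compact_op :: "(dirichlet \<Rightarrow> dirichlet) \<Rightarrow> bool" where
  "compact_op T \<longleftrightarrow> bounded_op T \<and> compact (closure (T ` cball 0 1))"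

text \<open>
  The case distinction is needed because \<open>dirichlet.dim\<close> is 0 on infinite-dimensional subspaces.
\<close>

definition op_rank :: "(dirichlet \<Rightarrow> dirichlet) \<Rightarrow> enat" where
  "op_rank R = (if \<exists>B. finite B \<and> range R \<subseteq> dirichlet.span B
     then enat (dirichlet.dim (range R)) else \<infinity>)"

definition approx_number :: "nat \<Rightarrow> (dirichlet \<Rightarrow> dirichlet) \<Rightarrow> real" where
  "approx_number n T = Inf {onorm (\<lambda>f. T f - R f) | R. bounded_op R \<and> op_rank R < enat n}"

text \<open>
  A composition operator on the whole Dirichlet space exists only for some symbols \<open>\<phi>\<close>; if it
  does, it is uniquely determined by \<open>\<phi>\<close>.
\<close>

definition composition_op :: "(complex \<Rightarrow> complex) \<Rightarrow> (dirichlet \<Rightarrow> dirichlet) \<Rightarrow> bool" where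
  "composition_op \<phi> C \<longleftrightarrow> (\<forall>f. \<forall>z\<in>unit_disk. dfun (C f) z = dfun f (\<phi> z))"

end

theory Submission
  imports Defs
begin

text \<open>
  For a univalent symbol \<open>\<phi>\<close> the change of variables formula gives
  \<open>\<parallel>C f\<parallel>\<^sup>2 = \<bar>f (\<phi> 0)\<bar>\<^sup>2 + (1/\<pi>) \<integral> \<bar>f'\<bar>\<^sup>2\<close>, integrated over the image of \<open>\<phi>\<close>, so only
  that image matters. It is taken to be a cusp at 1 whose width at distance \<open>2\<^sup>-\<^sup>s\<close> from 1 is
  about \<open>\<delta> s 2\<^sup>-\<^sup>s\<close>, with \<open>\<delta>\<close> decreasing to 0 as slowly as needed; it is starlike, so a Riemann map
  exists. Compactness: by the area mean value property, the part of the cusp within \<open>2\<^sup>-\<^sup>J\<close> of 1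
  carries at most a constant times \<open>\<delta> J\<close> of the Dirichlet integral of any \<open>f\<close>, and on the rest
  normal families apply. Lower bound: the cusp contains disjoint disks of relative size
  \<open>\<delta> s\<close> at the scales \<open>2\<^sup>-\<^sup>s\<close>, \<open>s = 10, 20, ..., 10 n\<close>. Sums of monomials over disjoint frequency
  blocks \<open>{N<..2N}\<close>, \<open>N = 2\<^sup>s\<^sup>-\<^sup>1\<close>, are orthogonal, and their derivatives at the
  centres of these disks form a diagonally dominant matrix. So \<open>C\<close> is bounded below by a constant
  times \<open>\<delta> (10 n)\<close> on an \<open>n\<close>-dimensional subspace, which every operator of rank less than \<open>n\<close>
  annihilates somewhere.
\<close>

section \<open>Conformal change of variables\<close>


text \<open>Compactness and slow decay pull in opposite directions. If the relative width
  \<open>\<delta>\<close> stayed bounded below, the lower bound would keep all approximation numbers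
  away from 0 and \<open>C\<close> could not be compact. So \<open>\<delta>\<close> has to tend to
  0, but compactness asks for no rate. The rate is free because the scales are geometric: each of
  them contributes one almost independent direction, and n directions already fit into the first 10
  n scales. The width at scale 10 n can therefore be a fixed multiple of a decreasing majorant of
  \<open>\<epsilon> n\<close>. The lower bound is linear in \<open>\<delta>\<close> for the
  following reason. A disk of radius \<open>\<delta>\<close> h carries Dirichlet integral at least
  pi (\<open>\<delta>\<close> h)^2 |f'|^2, with f' taken at its centre, and at distance 2 h from 1 a
  function of bounded norm can have slope of order 1/h. The step of 10 between scales separates the
  frequencies by a factor 1024, so crude estimates of the off-diagonal entries are enough for
  diagonal dominance.\<close>

definition complex_of_vec :: "real ^ 2 \<Rightarrow> complex" where
  "complex_of_vec v = Complex (v $ 1) (v $ 2)"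

definition vec_of_complex :: "complex \<Rightarrow> real ^ 2" where
  "vec_of_complex z = vector [Re z, Im z]"

lemma vec_of_complex_nth [simp]:
  "vec_of_complex z $ 1 = Re z" "vec_of_complex z $ 2 = Im z"
  by (simp_all add: vec_of_complex_def vector_2)

lemma complex_of_vec_inverse [simp]: "vec_of_complex (complex_of_vec v) = v"
  by (simp add: vec_eq_iff forall_2 complex_of_vec_def)

lemma vec_of_complex_inverse [simp]: "complex_of_vec (vec_of_complex z) = z"
  by (simp add: complex_of_vec_def complex_eq_iff)

lemma bounded_linear_complex_of_vec: "bounded_linear complex_of_vec"
  by (rule linear_conv_bounded_linear[THEN iffD1])
     (auto intro!: linearI simp: complex_of_vec_def complex_eq_iff)

lemma bounded_linear_vec_of_complex: "bounded_linear vec_of_complex"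
  by (rule linear_conv_bounded_linear[THEN iffD1])
     (auto intro!: linearI simp: vec_eq_iff forall_2)

lemma complex_of_vec_measurable [measurable]: "complex_of_vec \<in> borel_measurable borel"
  by (intro borel_measurable_continuous_onI linear_continuous_on bounded_linear_complex_of_vec)

lemma Basis_vec_2: "(Basis :: (real ^ 2) set) = {axis 1 1, axis 2 1}"
proof (intro set_eqI iffI)
  fix x :: "real ^ 2" assume "x \<in> Basis"
  then obtain i :: 2 where "x = axis i 1" by (auto simp: Basis_vec_def)
  then show "x \<in> {axis 1 1, axis 2 1}" using exhaust_2[of i] by auto
qed (auto simp: Basis_vec_def)

text \<open>Carries Lebesgue measure over to \<open>real ^ 2\<close>, where the change of variables
  theorem is phrased with determinants of matrices. \<open>lborel_eqI\<close> asks only for the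
  measure of boxes, and boxes pull back to boxes with the same side lengths.\<close>

lemma lborel_complex_eq: "(lborel :: complex measure) = distr lborel borel complex_of_vec"
proof (rule lborel_eqI)
  fix l u :: complex
  assume le: "\<And>b. b \<in> Basis \<Longrightarrow> l \<bullet> b \<le> u \<bullet> b"
  have le': "Re l \<le> Re u" "Im l \<le> Im u"
    using le[of 1] le[of \<i>] by (auto simp: Basis_complex_def)
  have eq: "complex_of_vec -` box l u = box (vec_of_complex l) (vec_of_complex u)"
    by (auto simp: box_def Basis_vec_2 Basis_complex_def inner_axis complex_of_vec_def)
  have "emeasure (distr lborel borel complex_of_vec) (box l u) =
      emeasure lborel (box (vec_of_complex l) (vec_of_complex u))"
    by (subst emeasure_distr) (auto simp: eq)
  also have "\<dots> = (\<Prod>b\<in>Basis. (vec_of_complex u - vec_of_complex l) \<bullet> b)"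
    using le' by (intro emeasure_lborel_box) (auto simp: Basis_vec_2 inner_axis)
  also have "(\<Prod>b\<in>Basis. (vec_of_complex u - vec_of_complex l) \<bullet> b) = (\<Prod>b\<in>Basis. (u - l) \<bullet> b)"
    by (auto simp: Basis_vec_2 Basis_complex_def inner_axis axis_eq_axis)
  finally show "emeasure (distr lborel borel complex_of_vec) (box l u) =
      ennreal (\<Prod>b\<in>Basis. (u - l) \<bullet> b)" .
qed simp

text \<open>Multiplication by a + bi has the matrix with rows (a, -b) and (b, a), of determinant a^2
  + b^2. By the Cauchy-Riemann equations this is the Jacobian of a holomorphic map with derivative
  \<open>c\<close>.\<close>

lemma det_matrix_complex_mult:
  "det (matrix (\<lambda>v. vec_of_complex (c * complex_of_vec v))) = (cmod c)\<^sup>2"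
  by (simp add: det_2 matrix_def axis_def complex_of_vec_def cmod_power2 flip: power2_eq_square)

lemma emeasure_complex_eq_vec:
  assumes "A \<in> sets (borel :: complex measure)"
  shows "emeasure lborel A = emeasure lborel (complex_of_vec -` A)"
  using assms by (subst lborel_complex_eq, subst emeasure_distr) auto

lemma nn_integral_complex_eq_vec:
  fixes f :: "complex \<Rightarrow> ennreal"
  assumes [measurable]: "f \<in> borel_measurable borel"
  shows "(\<integral>\<^sup>+z. f z \<partial>lborel) = (\<integral>\<^sup>+v. f (complex_of_vec v) \<partial>lborel)"
  by (subst lborel_complex_eq, subst nn_integral_distr) auto

text \<open>Conjugation with \<open>complex_of_vec\<close> turns \<open>\<phi>\<close> into a map
  \<open>g\<close> of \<open>real ^ 2\<close> with Jacobian |deriv \<open>\<phi>\<close>|^2.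
  Boundedness of the image makes its measure finite, so that it can be the value of a real
  integral.\<close>

lemma emeasure_holomorphic_image:
  fixes \<phi> :: "complex \<Rightarrow> complex"
  assumes "open U" and hol: "\<phi> holomorphic_on U" and inj: "inj_on \<phi> U"
    and bd: "bounded (\<phi> ` U)" and S: "S \<in> sets borel" "S \<subseteq> U" and im: "\<phi> ` S \<in> sets borel"
  shows "emeasure lborel (\<phi> ` S) = (\<integral>\<^sup>+z\<in>S. ennreal ((cmod (deriv \<phi> z))\<^sup>2) \<partial>lborel)"
proof -
  define g where "g = (\<lambda>v. vec_of_complex (\<phi> (complex_of_vec v)))"
  define g' where "g' = (\<lambda>v w. vec_of_complex (deriv \<phi> (complex_of_vec v) * complex_of_vec w))"
  define T where "T = complex_of_vec -` S"
  have T: "T \<in> sets borel"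
    using measurable_sets_borel[OF complex_of_vec_measurable S(1)] by (simp add: T_def)
  have "(g has_derivative g' v) (at v)" if "v \<in> T" for v
  proof -
    have "(\<phi> has_derivative (*) (deriv \<phi> (complex_of_vec v))) (at (complex_of_vec v))"
      using holomorphic_derivI[OF hol \<open>open U\<close>, of "complex_of_vec v"] that S(2)
      by (auto simp: T_def has_field_derivative_def)
    moreover have "(complex_of_vec has_derivative complex_of_vec) (at v)"
      by (intro bounded_linear_imp_has_derivative bounded_linear_complex_of_vec)
    ultimately have "((\<lambda>v. \<phi> (complex_of_vec v)) has_derivative
        (\<lambda>w. deriv \<phi> (complex_of_vec v) * complex_of_vec w)) (at v)"
      using has_derivative_compose by fastforce
    then show ?thesis
      unfolding g_def g'_def by (rule bounded_linear.has_derivative[OF bounded_linear_vec_of_complex])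
  qed
  then have der: "(g has_derivative g' v) (at v within T)" if "v \<in> T" for v
    using that has_derivative_at_withinI by blast
  have injg: "inj_on g T"
  proof (rule inj_onI)
    fix x y assume xy: "x \<in> T" "y \<in> T" "g x = g y"
    then have "\<phi> (complex_of_vec x) = \<phi> (complex_of_vec y)"
      unfolding g_def by (metis vec_of_complex_inverse)
    then have "complex_of_vec x = complex_of_vec y"
      using inj xy(1,2) S(2) by (auto simp: T_def inj_on_def)
    then show "x = y" by (metis complex_of_vec_inverse)
  qed
  have gT: "g ` T = complex_of_vec -` (\<phi> ` S)"
  proof (intro set_eqI iffI)
    fix v assume "v \<in> complex_of_vec -` (\<phi> ` S)"
    then obtain z where z: "z \<in> S" "complex_of_vec v = \<phi> z" by auto
    then have "v = g (vec_of_complex z)" "vec_of_complex z \<in> T"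
      by (simp_all add: g_def T_def flip: z(2))
    then show "v \<in> g ` T" by blast
  qed (auto simp: g_def T_def)
  have gTb: "g ` T \<in> sets borel"
    using measurable_sets_borel[OF complex_of_vec_measurable im] by (simp add: gT)
  have "bounded (vec_of_complex ` \<phi> ` U)"
    by (rule bounded_linear_image[OF bd bounded_linear_vec_of_complex])
  then have bg: "bounded (g ` T)"
    by (rule bounded_subset) (use S(2) in \<open>auto simp: g_def T_def\<close>)
  have gTl: "g ` T \<in> lmeasurable"
    using bg gTb by (simp add: bounded_set_imp_lmeasurable)
  have "((\<lambda>v. \<bar>det (matrix (g' v))\<bar>) has_integral measure lebesgue (g ` T)) T"
    using iffD1[OF has_measure_differentiable_image[of T g g', OF _ der injg], of "measure lebesgue (g ` T)"] gTl T
    by simp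
  then have hi: "((\<lambda>v. (cmod (deriv \<phi> (complex_of_vec v)))\<^sup>2) has_integral measure lebesgue (g ` T)) T"
    by (simp add: g'_def det_matrix_complex_mult)
  have mU: "(\<lambda>z. indicator U z *\<^sub>R deriv \<phi> z) \<in> borel_measurable borel"
    using borel_measurable_continuous_on_indicator[of U "deriv \<phi>"] \<open>open U\<close> hol
    by (simp add: holomorphic_on_imp_continuous_on holomorphic_deriv)
  \<comment> \<open>Nothing is known of \<open>deriv \<phi>\<close> outside \<open>U\<close>.
    Multiplied by the indicator of \<open>U\<close> it is measurable on the whole plane, and on
    \<open>S\<close> it is unchanged.\<close>
  have eqm: "(\<lambda>z. (cmod (deriv \<phi> z))\<^sup>2 * indicator S z) =
      (\<lambda>z. (cmod (indicator U z *\<^sub>R deriv \<phi> z))\<^sup>2 * indicator S z)"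
    using S(2) by (auto simp: fun_eq_iff split: split_indicator)
  have ms: "(\<lambda>z. (cmod (deriv \<phi> z))\<^sup>2 * indicator S z) \<in> borel_measurable borel"
    unfolding eqm using mU S(1) by measurable
  have "((\<lambda>v. (cmod (deriv \<phi> (complex_of_vec v)))\<^sup>2 * indicator S (complex_of_vec v))
      has_integral measure lebesgue (g ` T)) UNIV"
    using hi[unfolded has_integral_restrict_UNIV[of T, symmetric]]
    by (rule has_integral_eq[rotated]) (auto simp: T_def)
  then have "(\<integral>\<^sup>+v. ennreal ((cmod (deriv \<phi> (complex_of_vec v)))\<^sup>2 * indicator S (complex_of_vec v)) \<partial>lborel)
      = ennreal (measure lebesgue (g ` T))"
    using nn_integral_has_integral_lborel[OF measurable_compose[OF complex_of_vec_measurable ms], of "measure lebesgue (g ` T)"]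
    by simp
  then have "(\<integral>\<^sup>+z. ennreal ((cmod (deriv \<phi> z))\<^sup>2 * indicator S z) \<partial>lborel) = ennreal (measure lebesgue (g ` T))"
    using ms by (subst nn_integral_complex_eq_vec) simp_all
  also have "\<dots> = emeasure lborel (g ` T)"
    using gTl gTb emeasure_eq_measure2[of "g ` T" lebesgue] by (simp add: fmeasurable_def)
  also have "\<dots> = emeasure lborel (\<phi> ` S)"
    using im by (simp add: emeasure_complex_eq_vec gT)
  finally show ?thesis
    by (simp add: ennreal_mult'' ennreal_indicator)
qed

text \<open>By \<open>emeasure_holomorphic_image\<close>, \<open>\<phi>\<close> pushes the measure
  with density |deriv \<open>\<phi>\<close>|^2 on \<open>U\<close> forward to Lebesgue measure on
  the image. The formula results from integrating \<open>h\<close> against these two equal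
  measures.\<close>

lemma nn_integral_conformal_substitution:
  fixes \<phi> :: "complex \<Rightarrow> complex" and h :: "complex \<Rightarrow> ennreal"
  assumes "open U" and hol: "\<phi> holomorphic_on U" and inj: "inj_on \<phi> U"
    and bd: "bounded (\<phi> ` U)" and h [measurable]: "h \<in> borel_measurable borel"
  shows "(\<integral>\<^sup>+z\<in>U. h (\<phi> z) * ennreal ((cmod (deriv \<phi> z))\<^sup>2) \<partial>lborel) = (\<integral>\<^sup>+w\<in>\<phi> ` U. h w \<partial>lborel)"
proof -
  define \<psi> where "\<psi> = (\<lambda>z. indicator U z *\<^sub>R \<phi> z)"
  define d where "d = (\<lambda>z. indicator U z *\<^sub>R deriv \<phi> z)"
  have U [measurable]: "U \<in> sets borel" using \<open>open U\<close> by simp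
  have oim: "open (\<phi> ` U)"
    by (rule open_mapping_thm3[OF hol \<open>open U\<close> inj])
  have [measurable]: "\<phi> ` U \<in> sets borel" using oim by simp
  have m\<psi> [measurable]: "\<psi> \<in> borel_measurable borel"
    unfolding \<psi>_def using borel_measurable_continuous_on_indicator[of U \<phi>] hol
    by (simp add: holomorphic_on_imp_continuous_on)
  have md [measurable]: "d \<in> borel_measurable borel"
    unfolding d_def using borel_measurable_continuous_on_indicator[of U "deriv \<phi>"] hol \<open>open U\<close>
    by (simp add: holomorphic_on_imp_continuous_on holomorphic_deriv)
  let ?w = "\<lambda>z. ennreal ((cmod (d z))\<^sup>2)"
  have eq: "distr (density lborel ?w) borel \<psi> = density lborel (indicator (\<phi> ` U))"
  proof (rule measure_eqI)
    fix A assume "A \<in> sets (distr (density lborel ?w) borel \<psi>)"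
    then have A [measurable]: "A \<in> sets borel" by simp
    define S where "S = U \<inter> \<psi> -` A"
    have S [measurable]: "S \<in> sets borel"
      unfolding S_def using measurable_sets_borel[OF m\<psi> A] by simp
    have im: "\<phi> ` S = A \<inter> \<phi> ` U"
      by (auto simp: S_def \<psi>_def)
    have "emeasure (distr (density lborel ?w) borel \<psi>) A = (\<integral>\<^sup>+z\<in>\<psi> -` A. ?w z \<partial>lborel)"
      using measurable_sets_borel[OF m\<psi> A]
      by (subst emeasure_distr) (simp_all add: emeasure_density)
    also have "\<dots> = (\<integral>\<^sup>+z\<in>S. ennreal ((cmod (deriv \<phi> z))\<^sup>2) \<partial>lborel)"
      by (intro nn_integral_cong) (auto simp: S_def d_def split: split_indicator)
    also have "\<dots> = emeasure lborel (A \<inter> \<phi> ` U)"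
      using emeasure_holomorphic_image[OF \<open>open U\<close> hol inj bd S, unfolded im] by (simp add: S_def)
    also have "\<dots> = emeasure (density lborel (indicator (\<phi> ` U))) A"
      by (subst emeasure_density)
         (auto simp: indicator_inter_arith[symmetric] Int_commute simp flip: nn_integral_indicator
               intro!: nn_integral_cong split: split_indicator)
    finally show "emeasure (distr (density lborel ?w) borel \<psi>) A =
        emeasure (density lborel (indicator (\<phi> ` U))) A" .
  qed simp
  have "(\<integral>\<^sup>+w\<in>\<phi> ` U. h w \<partial>lborel) = (\<integral>\<^sup>+w. h w \<partial>density lborel (indicator (\<phi> ` U)))"
    by (subst nn_integral_density) (auto simp: mult.commute)
  also have "\<dots> = (\<integral>\<^sup>+z. ?w z * h (\<psi> z) \<partial>lborel)"
    unfolding eq[symmetric] by (subst nn_integral_distr) (auto simp: nn_integral_density)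
  also have "\<dots> = (\<integral>\<^sup>+z\<in>U. h (\<phi> z) * ennreal ((cmod (deriv \<phi> z))\<^sup>2) \<partial>lborel)"
    by (intro nn_integral_cong) (auto simp: d_def \<psi>_def mult.commute split: split_indicator)
  finally show ?thesis by simp
qed

lemma lborel_distr_rotation:
  fixes u :: complex
  assumes u: "cmod u = 1"
  shows "distr lborel borel ((*) u) = lborel"
proof (rule lborel_eqI[symmetric])
  fix l r :: complex
  assume le: "\<And>b. b \<in> Basis \<Longrightarrow> l \<bullet> b \<le> r \<bullet> b"
  have u0: "u \<noteq> 0" using u by auto
  let ?S = "(*) u -` box l r"
  have meas: "(*) u \<in> borel_measurable borel" by simp
  have S: "?S \<in> sets borel" using measurable_sets_borel[OF meas] by simp
  have im: "(*) u ` ?S = box l r"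
  proof (intro set_eqI iffI)
    fix z assume "z \<in> box l r"
    then have "z / u \<in> ?S" "z = u * (z / u)" using u0 by simp_all
    then show "z \<in> (*) u ` ?S" by blast
  qed auto
  have op: "open ?S" by (intro open_vimage open_box continuous_intros)
  have "emeasure lborel (box l r) = (\<integral>\<^sup>+z\<in>?S. ennreal ((cmod (deriv ((*) u) z))\<^sup>2) \<partial>lborel)"
    using emeasure_holomorphic_image[of ?S "(*) u" ?S] op S u0 unfolding im
    by (auto simp: inj_on_def intro!: holomorphic_intros)
  also have "\<dots> = emeasure lborel ?S"
    using S by (simp add: u)
  finally show "emeasure (distr lborel borel ((*) u)) (box l r) = ennreal (\<Prod>b\<in>Basis. (r - l) \<bullet> b)"
    using le S by (subst emeasure_distr) auto
qed simp

section \<open>Area mean values on disks\<close>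


lemma emeasure_complex_ball: "r \<ge> 0 \<Longrightarrow> emeasure lborel (ball (c::complex) r) = ennreal (pi * r\<^sup>2)"
  by (simp add: emeasure_ball eval_unit_ball_vol mult.commute)

lemma measure_complex_ball: "r \<ge> 0 \<Longrightarrow> measure lborel (ball (c::complex) r) = pi * r\<^sup>2"
  by (simp add: measure_def emeasure_complex_ball)

lemma continuous_on_cball_imp_set_integrable_ball:
  fixes f :: "complex \<Rightarrow> 'a::{banach, second_countable_topology}"
  assumes "continuous_on (cball z r) f"
  shows "set_integrable lborel (ball z r) f"
proof -
  have "set_integrable lborel (cball z r) f"
    unfolding set_integrable_def using assms by (intro borel_integrable_compact) auto
  then show ?thesis
    by (rule set_integrable_subset) auto
qed

text \<open>Rotation by the angle pi / (m - k) preserves the disk and the measure but multiplies the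
  integrand by -1, so the integral equals its own negative.\<close>

lemma integral_monomials_orthogonal:
  assumes "m \<noteq> k"
  shows "(LINT w:ball 0 r|lborel. w ^ m * cnj w ^ k) = (0::complex)"
proof -
  define a where "a = pi / (real m - real k)"
  define u where "u = cis a"
  have nu: "cmod u = 1" by (simp add: u_def)
  have "u ^ m * cnj u ^ k = cis (real m * a - real k * a)"
    by (simp add: u_def cis_cnj Complex.DeMoivre cis_mult)
  also have "real m * a - real k * a = pi"
    using assms by (simp add: a_def diff_divide_distrib[symmetric] left_diff_distrib[symmetric])
  finally have u: "u ^ m * cnj u ^ k = - 1" by simp
  let ?f = "\<lambda>w::complex. indicator (ball 0 r) w *\<^sub>R (w ^ m * cnj w ^ k)"
  have [measurable]: "?f \<in> borel_measurable borel"
    by (intro borel_measurable_continuous_on_indicator continuous_intros) auto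
  have "(\<integral>w. ?f w \<partial>lborel) = (\<integral>w. ?f w \<partial>distr lborel borel ((*) u))"
    by (simp add: lborel_distr_rotation[OF nu])
  also have "\<dots> = (\<integral>w. ?f (u * w) \<partial>lborel)"
    by (subst integral_distr) auto
  also have "\<dots> = (\<integral>w. (u ^ m * cnj u ^ k) * ?f w \<partial>lborel)"
    by (intro Bochner_Integration.integral_cong)
       (auto simp: indicator_def norm_mult nu power_mult_distrib)
  also have "\<dots> = - (\<integral>w. ?f w \<partial>lborel)"
    by (simp add: u)
  finally show ?thesis by (simp add: set_lebesgue_integral_def)
qed

text \<open>Rotation symmetry kills every term but the constant one. Absolute summability at the
  radius \<open>s\<close> dominates the series on the whole disk and justifies exchanging sum and
  integral.\<close>

lemma integral_ball_power_series:
  fixes a :: "nat \<Rightarrow> complex"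
  assumes "0 < s" and sm: "summable (\<lambda>k. cmod (a k) * s ^ k)"
  shows "(LINT w:ball 0 s|lborel. (\<Sum>k. a k * w ^ k)) = pi * s\<^sup>2 * a 0"
proof -
  let ?g = "\<lambda>k w. indicator (ball 0 s) w *\<^sub>R (a k * w ^ k)"
  have int: "integrable lborel (?g k)" for k
    using continuous_on_cball_imp_set_integrable_ball[of 0 s "\<lambda>w. a k * w ^ k"]
    by (simp add: set_integrable_def continuous_intros)
  have le: "norm (?g k w) \<le> indicator (ball 0 s) w * (cmod (a k) * s ^ k)" for k w
    by (auto simp: indicator_def norm_mult norm_power intro!: mult_left_mono power_mono)
  have bnd: "norm (\<integral>w. norm (?g k w) \<partial>lborel) \<le> pi * s\<^sup>2 * (cmod (a k) * s ^ k)" for k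
  proof -
    have "(\<integral>w. norm (?g k w) \<partial>lborel) \<le> (\<integral>w. indicator (ball 0 s) w * (cmod (a k) * s ^ k) \<partial>(lborel :: complex measure))"
      using le by (intro integral_mono integrable_norm int) (auto simp: emeasure_complex_ball assms(1) less_imp_le)
    also have "\<dots> = pi * s\<^sup>2 * (cmod (a k) * s ^ k)"
      using assms(1) by (simp add: measure_complex_ball)
    finally show ?thesis by simp
  qed
  have sm': "summable (\<lambda>k. norm (?g k w))" for w
  proof (rule summable_comparison_test'[where N = 0])
    show "summable (\<lambda>k. indicator (ball 0 s) w * (cmod (a k) * s ^ k))"
      by (intro summable_mult sm)
  qed (use le in simp)
  have "(LINT w:ball 0 s|lborel. (\<Sum>k. a k * w ^ k)) = (\<integral>w. (\<Sum>k. ?g k w) \<partial>lborel)"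
    unfolding set_lebesgue_integral_def
    by (intro Bochner_Integration.integral_cong) (auto simp: indicator_def)
  also have "\<dots> = (\<Sum>k. \<integral>w. ?g k w \<partial>lborel)"
  proof (rule integral_suminf)
    show "summable (\<lambda>k. \<integral>w. norm (?g k w) \<partial>lborel)"
      by (rule summable_comparison_test'[where N = 0 and g = "\<lambda>k. pi * s\<^sup>2 * (cmod (a k) * s ^ k)"])
         (use bnd sm in \<open>auto intro!: summable_mult\<close>)
  qed (use int sm' in auto)
  also have "\<dots> = (\<Sum>k. if k = 0 then pi * s\<^sup>2 * a 0 else 0)"
  proof (intro suminf_cong)
    fix k
    have "(\<integral>w. ?g k w \<partial>lborel) = a k * (LINT w:ball 0 s|lborel. w ^ k * cnj w ^ 0)"
      by (simp add: set_lebesgue_integral_def flip: integral_mult_right_zero) 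
    also have "\<dots> = (if k = 0 then pi * s\<^sup>2 * a 0 else 0)"
      using integral_monomials_orthogonal[of k 0 s] assms(1)
      by (auto simp: set_lebesgue_integral_def measure_complex_ball scaleR_conv_of_real)
    finally show "(\<integral>w. ?g k w \<partial>lborel) = (if k = 0 then pi * s\<^sup>2 * a 0 else 0)" .
  qed
  also have "\<dots> = pi * s\<^sup>2 * a 0"
    using sums_single[of 0 "\<lambda>_. complex_of_real (pi * s\<^sup>2) * a 0"] by (simp add: sums_iff)
  finally show ?thesis .
qed

lemma holomorphic_area_mean_value:
  fixes F :: "complex \<Rightarrow> complex"
  assumes hol: "F holomorphic_on ball z R" and s: "0 < s" "s < R"
  shows "(LINT w:ball z s|lborel. F w) = pi * s\<^sup>2 * F z"
proof -
  define a where "a = (\<lambda>n. (deriv ^^ n) F z / fact n)"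
  have ser: "(\<lambda>n. a n * w ^ n) sums F (z + w)" if "cmod w < R" for w
    using holomorphic_power_series[OF hol, of "z + w"] that by (simp add: a_def dist_norm)
  \<comment> \<open>The midpoint of \<open>s\<close> and \<open>R\<close> is still inside the disk
    of convergence; convergence there gives absolute convergence at the smaller radius
    \<open>s\<close>.\<close>
  have "summable (\<lambda>n. a n * complex_of_real ((s + R) / 2) ^ n)"
    using ser[of "complex_of_real ((s + R) / 2)"] s
    by (auto simp: sums_iff norm_divide simp del: of_real_divide of_real_add)
  then have sm: "summable (\<lambda>n. cmod (a n * complex_of_real s ^ n))"
    by (rule powser_insidea) (use s in \<open>auto simp del: of_real_divide of_real_add\<close>)
  have eq: "(\<Sum>k. a k * w ^ k) = F (z + w)" if "w \<in> ball 0 s" for w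
    using ser[of w] that s by (simp add: sums_iff)
  have meas: "(\<lambda>w. indicator (ball z s) w *\<^sub>R F w) \<in> borel_measurable borel"
    using hol s by (intro borel_measurable_continuous_on_indicator holomorphic_on_imp_continuous_on)
      (auto elim: holomorphic_on_subset)
  have "(LINT w:ball z s|lborel. F w) = (\<integral>w. indicator (ball z s) w *\<^sub>R F w \<partial>distr lborel borel ((+) z))"
    by (simp add: lborel_distr_plus set_lebesgue_integral_def)
  also have "\<dots> = (\<integral>w. indicator (ball z s) (z + w) *\<^sub>R F (z + w) \<partial>lborel)"
    using meas by (subst integral_distr) auto
  also have "\<dots> = (LINT w:ball 0 s|lborel. (\<Sum>k. a k * w ^ k))"
    unfolding set_lebesgue_integral_def
    by (intro Bochner_Integration.integral_cong) (auto simp: indicator_def dist_norm eq)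
  also have "\<dots> = pi * s\<^sup>2 * a 0"
    using sm s by (intro integral_ball_power_series) (auto simp: norm_mult norm_power)
  finally show ?thesis by (simp add: a_def)
qed

text \<open>Expand the nonnegative integral of |F w - F z|^2. The mean value property evaluates the
  cross term as -2 pi s^2 |F z|^2, of which one half cancels against the integral of the constant |F
  z|^2.\<close>

lemma holomorphic_area_submean_value:
  assumes hol: "F holomorphic_on ball z R" and s: "0 < s" "s < R"
  shows "ennreal (pi * s\<^sup>2 * (cmod (F z))\<^sup>2) \<le> (\<integral>\<^sup>+w\<in>ball z s. ennreal ((cmod (F w))\<^sup>2) \<partial>lborel)"
proof -
  have cont: "continuous_on (cball z s) F"
    using hol s by (intro holomorphic_on_imp_continuous_on) (auto elim: holomorphic_on_subset)
  note i = continuous_on_cball_imp_set_integrable_ball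
  have iF: "set_integrable lborel (ball z s) F"
    and iF2: "set_integrable lborel (ball z s) (\<lambda>w. (cmod (F w))\<^sup>2)"
    and iin: "set_integrable lborel (ball z s) (\<lambda>w. F w \<bullet> F z)"
    and ic: "set_integrable lborel (ball z s) (\<lambda>w. (cmod (F z))\<^sup>2)"
    using cont by (auto intro!: i continuous_intros)
  have "0 \<le> (LINT w:ball z s|lborel. (cmod (F w - F z))\<^sup>2)"
    unfolding set_lebesgue_integral_def by (intro integral_nonneg_AE) auto
  also have "\<dots> = (LINT w:ball z s|lborel. ((cmod (F w))\<^sup>2 - 2 * (F w \<bullet> F z)) + (cmod (F z))\<^sup>2)"
    by (intro set_lebesgue_integral_cong)
       (auto simp: dot_square_norm[symmetric] inner_diff inner_commute)
  also have "\<dots> = (LINT w:ball z s|lborel. (cmod (F w))\<^sup>2) - 2 * (LINT w:ball z s|lborel. F w \<bullet> F z) +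
      (LINT w:ball z s|lborel. (cmod (F z))\<^sup>2)"
    using iF2 iin ic by (simp add: set_integral_add set_integral_diff)
  also have "(LINT w:ball z s|lborel. F w \<bullet> F z) = (LINT w:ball z s|lborel. F w) \<bullet> F z"
    using iF unfolding set_lebesgue_integral_def set_integrable_def
    by (subst integral_inner_left[symmetric]) auto
  also have "\<dots> = pi * s\<^sup>2 * (cmod (F z))\<^sup>2"
    unfolding holomorphic_area_mean_value[OF assms]
    by (simp add: dot_square_norm flip: scaleR_conv_of_real of_real_mult of_real_power)
  also have "(LINT w:ball z s|lborel. (cmod (F z))\<^sup>2) = pi * s\<^sup>2 * (cmod (F z))\<^sup>2"
    using s by (simp add: set_lebesgue_integral_def measure_complex_ball)
  finally have "pi * s\<^sup>2 * (cmod (F z))\<^sup>2 \<le> (LINT w:ball z s|lborel. (cmod (F w))\<^sup>2)" by simp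
  then have "ennreal (pi * s\<^sup>2 * (cmod (F z))\<^sup>2) \<le> ennreal (LINT w:ball z s|lborel. (cmod (F w))\<^sup>2)"
    by (rule ennreal_leI)
  also have "\<dots> = (\<integral>\<^sup>+w. ennreal (indicator (ball z s) w *\<^sub>R (cmod (F w))\<^sup>2) \<partial>lborel)"
    using iF2 unfolding set_lebesgue_integral_def set_integrable_def
    by (intro nn_integral_eq_integral[symmetric]) auto
  also have "\<dots> = (\<integral>\<^sup>+w\<in>ball z s. ennreal ((cmod (F w))\<^sup>2) \<partial>lborel)"
    by (intro nn_integral_cong) (auto split: split_indicator)
  finally show ?thesis .
qed

text \<open>In place of polar coordinates, the power of |z| is written as the integral of its radial
  derivative over [0, |z|]. After exchanging the integrals, the inner one is the area pi - pi r^2 of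
  an annulus. The exponent \<open>2 * Suc m\<close> keeps the derivative free of truncated
  subtraction.\<close>

lemma nn_integral_norm_power_ball:
  "(\<integral>\<^sup>+z\<in>ball 0 1. ennreal (cmod z ^ (2 * Suc m)) \<partial>lborel) = ennreal (pi / (m + 2))"
proof -
  let ?k = "\<lambda>r::real. 2 * real (Suc m) * r ^ (2 * m + 1)"
  have in1: "(\<integral>\<^sup>+r. ennreal (?k r) * indicator {0..x} r \<partial>lborel) = ennreal (x ^ (2 * Suc m))" if "x \<ge> 0" for x
  proof (subst nn_integral_FTC_Icc[where F = "\<lambda>r. r ^ (2 * Suc m)"])
    show "((\<lambda>r. r ^ (2 * Suc m)) has_real_derivative ?k r) (at r)" for r :: real
      by (rule derivative_eq_intros refl | simp)+
  qed (use that in auto)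
  have "(\<integral>\<^sup>+z\<in>ball 0 1. ennreal (cmod z ^ (2 * Suc m)) \<partial>lborel) =
     (\<integral>\<^sup>+z. \<integral>\<^sup>+r. ennreal (?k r) * indicator {(z, r). 0 \<le> r \<and> r \<le> cmod z \<and> cmod z < 1} (z, r) \<partial>lborel \<partial>lborel)"
    (is "_ = (\<integral>\<^sup>+z. \<integral>\<^sup>+r. ?h z r \<partial>lborel \<partial>lborel)")
  proof (intro nn_integral_cong)
    fix z :: complex
    have "(\<integral>\<^sup>+r. ?h z r \<partial>lborel) =
        (\<integral>\<^sup>+r. ennreal (?k r) * indicator {0..cmod z} r * indicator (ball 0 1) z \<partial>lborel)"
      by (intro nn_integral_cong) (auto split: split_indicator)
    then show "ennreal (cmod z ^ (2 * Suc m)) * indicator (ball 0 1) z = (\<integral>\<^sup>+r. ?h z r \<partial>lborel)"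
      using in1[of "cmod z"] by (simp only: nn_integral_multc) (simp add: nn_integral_multc)
  qed
  also have "\<dots> = (\<integral>\<^sup>+r. \<integral>\<^sup>+z. ?h z r \<partial>lborel \<partial>lborel)"
    by (intro lborel_pair.Fubini') measurable
  also have "\<dots> = (\<integral>\<^sup>+r. ennreal (?k r * (pi - pi * r\<^sup>2)) * indicator {0..1} r \<partial>lborel)"
  proof (intro nn_integral_cong)
    fix r :: real
    have "(\<integral>\<^sup>+z. ?h z r \<partial>lborel) = (\<integral>\<^sup>+z. ennreal (?k r) * indicator {0..1} r * indicator (ball 0 1 - ball (0::complex) r) z \<partial>lborel)"
      by (intro nn_integral_cong) (auto split: split_indicator)
    also have "\<dots> = ennreal (?k r) * indicator {0..1} r * emeasure lborel (ball 0 1 - ball (0::complex) r)"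
      by (intro nn_integral_cmult_indicator) simp
    also have "\<dots> = ennreal (?k r * (pi - pi * r\<^sup>2)) * indicator {0..1} r"
    proof (cases "r \<in> {0..1}")
      case True
      then have "emeasure lborel (ball 0 1 - ball (0::complex) r) = ennreal pi - ennreal (pi * r\<^sup>2)"
        by (subst emeasure_Diff) (auto simp: emeasure_complex_ball)
      also have "\<dots> = ennreal (pi - pi * r\<^sup>2)"
        by (simp add: ennreal_minus)
      finally show ?thesis using True by (simp add: ennreal_mult')
    qed simp
    finally show "(\<integral>\<^sup>+z. ?h z r \<partial>lborel) = ennreal (?k r * (pi - pi * r\<^sup>2)) * indicator {0..1} r" .
  qed
  also have "\<dots> = ennreal (pi / (m + 2))"
  proof (subst nn_integral_FTC_Icc[where F = "\<lambda>r. pi * r ^ (2 * Suc m) - pi * Suc m / (m + 2) * r ^ (2 * Suc (Suc m))"])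
    fix x :: real assume x: "x \<in> {0..1}"
    show "((\<lambda>r. pi * r ^ (2 * Suc m) - pi * Suc m / (m + 2) * r ^ (2 * Suc (Suc m))) has_real_derivative
        ?k x * (pi - pi * x\<^sup>2)) (at x)"
      by (rule derivative_eq_intros refl | simp)+
         (simp add: field_simps power2_eq_square)
    have "x\<^sup>2 \<le> 1" using x by (simp add: power_le_one)
    then show "0 \<le> ?k x * (pi - pi * x\<^sup>2)" using x by simp
  next
    show "ennreal (pi * 1 ^ (2 * Suc m) - pi * Suc m / (m + 2) * 1 ^ (2 * Suc (Suc m)) -
      (pi * 0 ^ (2 * Suc m) - pi * Suc m / (m + 2) * 0 ^ (2 * Suc (Suc m)))) = ennreal (pi / (m + 2))"
      by (intro arg_cong[where f = ennreal]) (simp add: field_simps)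
  qed auto
  finally show ?thesis .
qed

section \<open>The cusp domain\<close>


text \<open>All boxes reach back to real part -1/2, so those with s >= 1 contain 0 and their union
  is starlike about 0. Only boxes of high index come close to 1, and these are flat, which produces
  the cusp.\<close>

definition cusp_box :: "(nat \<Rightarrow> real) \<Rightarrow> nat \<Rightarrow> complex set" where
  "cusp_box \<delta> s = {z. - 1 / 2 < Re z \<and> Re z < 1 - (1 / 2) ^ s \<and> \<bar>Im z\<bar> < \<delta> s * (1 / 2) ^ s}"

text \<open>The index starts at 1 because the right edge of \<open>cusp_box \<delta> 0\<close> lies
  at real part 0, so that this box would miss the centre 0.\<close>

definition cusp_domain :: "(nat \<Rightarrow> real) \<Rightarrow> complex set" where
  "cusp_domain \<delta> = (\<Union>s\<in>{1..}. cusp_box \<delta> s)"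

lemma cusp_box_eq_box:
  "cusp_box \<delta> s = box (Complex (- 1 / 2) (- (\<delta> s * (1 / 2) ^ s))) (Complex (1 - (1 / 2) ^ s) (\<delta> s * (1 / 2) ^ s))"
  by (auto simp: cusp_box_def box_def Basis_complex_def)

lemma open_cusp_domain: "open (cusp_domain \<delta>)"
  by (auto simp: cusp_domain_def cusp_box_eq_box)

lemma cusp_domain_borel [measurable]: "cusp_domain \<delta> \<in> sets borel"
  using open_cusp_domain by simp

lemma zero_in_cusp_box:
  assumes "\<And>s. 0 < \<delta> s" "s \<ge> 1"
  shows "0 \<in> cusp_box \<delta> s"
  using assms power_decreasing[of 1 s "1 / 2 :: real"] by (auto simp: cusp_box_def)

lemma starlike_cusp_domain:
  assumes "\<And>s. 0 < \<delta> s"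
  shows "starlike (cusp_domain \<delta>)"
  unfolding starlike_def
proof (intro bexI ballI)
  show "0 \<in> cusp_domain \<delta>"
    using zero_in_cusp_box[of \<delta> 1, OF assms] by (auto simp: cusp_domain_def)
  fix z assume "z \<in> cusp_domain \<delta>"
  then obtain s where s: "s \<ge> 1" "z \<in> cusp_box \<delta> s" by (auto simp: cusp_domain_def)
  then have "closed_segment 0 z \<subseteq> cusp_box \<delta> s"
    using zero_in_cusp_box[of \<delta> s, OF assms] convex_box(2)
    unfolding cusp_box_eq_box by (intro closed_segment_subset) auto
  then show "closed_segment 0 z \<subseteq> cusp_domain \<delta>"
    using s(1) by (auto simp: cusp_domain_def)
qed

lemma cusp_box_norm_bound:
  assumes "\<delta> s \<le> 1 / 2" "s \<ge> 1" "z \<in> cusp_box \<delta> s"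
  shows "cmod z < 1"
proof -
  have le: "\<delta> s * (1 / 2) ^ s \<le> 1 / 2 * (1 / 2) ^ s"
    using assms(1) by (intro mult_right_mono) auto
  have "(1 / 2) ^ s \<le> (1 / 2 :: real)"
    using power_decreasing[of 1 s "1 / 2 :: real"] assms(2) by simp
  then have "\<bar>Re z\<bar> + \<bar>Im z\<bar> < 1"
    using assms(3) le unfolding cusp_box_def mem_Collect_eq by linarith
  then show ?thesis using cmod_le[of z] by linarith
qed

lemma cusp_domain_subset_unit_disk:
  assumes "\<And>s. \<delta> s \<le> 1 / 2"
  shows "cusp_domain \<delta> \<subseteq> unit_disk"
  using cusp_box_norm_bound[OF assms] by (auto simp: cusp_domain_def)

text \<open>The centre lies \<open>(1 / 2) ^ s\<close> to the left of the right edge of box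
  \<open>s\<close>, and the radius is half the height of that box. The test functions are measured
  on these disks.\<close>

lemma ball_subset_cusp_domain:
  assumes "\<delta> s \<le> 1 / 2" "s \<ge> 1"
  shows "ball (of_real (1 - 2 * (1 / 2) ^ s)) (\<delta> s * (1 / 2) ^ s) \<subseteq> cusp_domain \<delta>"
proof
  fix z :: complex
  assume "z \<in> ball (of_real (1 - 2 * (1 / 2) ^ s)) (\<delta> s * (1 / 2) ^ s)"
  then have z: "cmod (z - of_real (1 - 2 * (1 / 2) ^ s)) < \<delta> s * (1 / 2) ^ s"
    by (simp add: dist_norm norm_minus_commute)
  have le: "\<delta> s * (1 / 2) ^ s \<le> 1 / 2 * (1 / 2) ^ s"
    using assms(1) by (intro mult_right_mono) auto
  have "(1 / 2) ^ s \<le> (1 / 2 :: real)"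
    using power_decreasing[of 1 s "1 / 2 :: real"] assms(2) by simp
  moreover have "\<bar>Re z - (1 - 2 * (1 / 2) ^ s)\<bar> < \<delta> s * (1 / 2) ^ s"
    using z abs_Re_le_cmod[of "z - of_real (1 - 2 * (1 / 2) ^ s)"] by simp
  moreover have "\<bar>Im z\<bar> < \<delta> s * (1 / 2) ^ s"
    using z abs_Im_le_cmod[of "z - of_real (1 - 2 * (1 / 2) ^ s)"] by simp
  ultimately have "z \<in> cusp_box \<delta> s"
    using le unfolding cusp_box_def mem_Collect_eq by linarith
  then show "z \<in> cusp_domain \<delta>"
    using assms(2) by (auto simp: cusp_domain_def)
qed

text \<open>A point this close to 1 lies only in boxes of index greater than \<open>j\<close>. Their
  half-heights obey the bound because both factors decrease with the index.\<close>

lemma cusp_domain_Im_bound: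
  assumes "decseq \<delta>" "\<And>s. 0 < \<delta> s" "z \<in> cusp_domain \<delta>" "1 - (1 / 2) ^ j \<le> Re z"
  shows "\<bar>Im z\<bar> < \<delta> j * (1 / 2) ^ Suc j"
proof -
  obtain s where s: "z \<in> cusp_box \<delta> s" using assms(3) by (auto simp: cusp_domain_def)
  then have "(1 / 2) ^ s < (1 / 2 :: real) ^ j"
    using assms(4) unfolding cusp_box_def mem_Collect_eq by linarith
  then have "j < s" by simp
  then have "\<delta> s * (1 / 2) ^ s \<le> \<delta> j * (1 / 2) ^ Suc j"
    using assms(1,2) by (intro mult_mono power_decreasing) (auto simp: decseq_def less_imp_le)
  then show ?thesis using s by (auto simp: cusp_box_def)
qed

text \<open>The part of the cusp away from 1 stays in a compact disk, where locally uniform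
  convergence controls the derivatives.\<close>

lemma cusp_domain_norm_bound:
  assumes "\<And>s. \<delta> s \<le> 1 / 2" "z \<in> cusp_domain \<delta>" "Re z < 1 - (1 / 2) ^ J" "J \<ge> 1"
  shows "cmod z \<le> 1 - (1 / 2) ^ Suc J"
proof -
  obtain s where s: "s \<ge> 1" "z \<in> cusp_box \<delta> s" using assms(2) by (auto simp: cusp_domain_def)
  have z: "- 1 / 2 < Re z" "Re z < 1 - (1 / 2) ^ s" "\<bar>Im z\<bar> < \<delta> s * (1 / 2) ^ s"
    using s(2) by (auto simp: cusp_box_def)
  have "\<delta> s * (1 / 2) ^ s \<le> 1 / 2 * (1 / 2) ^ s"
    using assms(1)[of s] by (intro mult_right_mono) auto
  then have im: "\<bar>Im z\<bar> < 1 / 2 * (1 / 2) ^ s" using z(3) by linarith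
  have half: "(1 / 2) ^ n \<le> (1 / 2 :: real)" if "n \<ge> 1" for n
    using power_decreasing[of 1 n "1 / 2 :: real"] that by simp
  have "\<bar>Re z\<bar> + \<bar>Im z\<bar> \<le> 1 - (1 / 2) ^ J / 2"
  \<comment> \<open>If s <= J, the right edge of the box bounds the real part; otherwise the
    assumption on \<open>Re z\<close> does. In both cases the imaginary part uses up at most half of
    the gap to 1.\<close>
  proof (cases "s \<le> J")
    case True
    then have "(1 / 2 :: real) ^ J \<le> (1 / 2) ^ s" by (intro power_decreasing) auto
    then show ?thesis using z(1,2) im half[OF s(1)] half[OF assms(4)] by linarith
  next
    case False
    then have "(1 / 2 :: real) ^ s \<le> (1 / 2) ^ J" by (intro power_decreasing) auto
    then show ?thesis using z(1) assms(3) im half[OF s(1)] half[OF assms(4)] by linarith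
  qed
  then show ?thesis using cmod_le[of z] by simp
qed

section \<open>Dirichlet integrals over the tail of the cusp\<close>

lemma borel_measurable_norm_power2_on:
  fixes F :: "complex \<Rightarrow> complex"
  assumes "continuous_on U F" "U \<in> sets borel" "S \<in> sets borel" "S \<subseteq> U"
  shows "(\<lambda>z. ennreal ((cmod (F z))\<^sup>2) * indicator S z) \<in> borel_measurable borel"
proof -
  have [measurable]: "(\<lambda>z. indicator U z *\<^sub>R F z) \<in> borel_measurable borel"
    using assms by (intro borel_measurable_continuous_on_indicator)
  have [measurable]: "S \<in> sets borel" by fact
  have "(\<lambda>z. ennreal ((cmod (F z))\<^sup>2) * indicator S z) =
      (\<lambda>z. ennreal ((cmod (indicator U z *\<^sub>R F z))\<^sup>2) * indicator S z)"
    using assms(4) by (auto simp: fun_eq_iff split: split_indicator)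
  moreover have "\<dots> \<in> borel_measurable borel" by measurable
  ultimately show ?thesis by (simp only:)
qed

definition cusp_piece :: "(nat \<Rightarrow> real) \<Rightarrow> nat \<Rightarrow> complex set" where
  "cusp_piece \<delta> j = {z\<in>cusp_domain \<delta>. 1 - (1 / 2) ^ j \<le> Re z \<and> Re z < 1 - (1 / 2) ^ Suc j}"

text \<open>The range of real parts of \<open>cusp_piece \<delta> j\<close>, widened on both sides
  by \<open>(1 / 2) ^ j / 8\<close>: room for a disk of that radius about every point of the
  piece.\<close>

definition disk_strip :: "nat \<Rightarrow> complex set" where
  "disk_strip j = {z\<in>unit_disk. 1 - 9 / 8 * (1 / 2) ^ j < Re z \<and> Re z < 1 - 3 / 8 * (1 / 2) ^ j}"

lemma cusp_piece_borel [measurable]: "cusp_piece \<delta> j \<in> sets borel"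
proof -
  have "cusp_piece \<delta> j = cusp_domain \<delta> \<inter> {z. 1 - (1 / 2) ^ j \<le> Re z} \<inter> {z. Re z < 1 - (1 / 2) ^ Suc j}"
    by (auto simp: cusp_piece_def)
  then show ?thesis by simp
qed

lemma disk_strip_borel [measurable]: "disk_strip j \<in> sets borel"
proof -
  have "disk_strip j = ball 0 1 \<inter> {z. 1 - 9 / 8 * (1 / 2) ^ j < Re z} \<inter> {z. Re z < 1 - 3 / 8 * (1 / 2) ^ j}"
    by (auto simp: disk_strip_def)
  then show ?thesis by simp
qed

lemma emeasure_cusp_piece:
  assumes "decseq \<delta>" "\<And>s. 0 < \<delta> s"
  shows "emeasure lborel (cusp_piece \<delta> j) \<le> ennreal (2 * \<delta> j * (1 / 4) ^ Suc j)"
proof -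
  let ?h = "\<delta> j * (1 / 2) ^ Suc j"
  let ?l = "Complex (1 - (1 / 2) ^ j) (- ?h)" and ?u = "Complex (1 - (1 / 2) ^ Suc j) ?h"
  have "cusp_piece \<delta> j \<subseteq> cbox ?l ?u"
    using cusp_domain_Im_bound[OF assms, of _ j]
    by (fastforce simp: cusp_piece_def cbox_def Basis_complex_def)
  then have "emeasure lborel (cusp_piece \<delta> j) \<le> emeasure lborel (cbox ?l ?u)"
    by (intro emeasure_mono) auto
  also have "\<dots> = ennreal (\<Prod>b\<in>Basis. (?u - ?l) \<bullet> b)"
    using assms(2)[of j] by (intro emeasure_lborel_cbox) (auto simp: Basis_complex_def)
  also have "(\<Prod>b\<in>Basis. (?u - ?l) \<bullet> b) = 2 * \<delta> j * ((1 / 2) ^ Suc j * (1 / 2) ^ Suc j)"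
    by (simp add: Basis_complex_def algebra_simps)
  also have "(1 / 2) ^ Suc j * (1 / 2) ^ Suc j = (1 / 4 :: real) ^ Suc j"
    by (subst power_mult_distrib[symmetric]) simp
  finally show ?thesis .
qed

text \<open>Put q = \<open>(1 / 2) ^ j\<close>. On the piece |Im z| < q/4 and Re z < 1 - q/2, so the
  disk of radius q/4 about z stays in the unit disk and the submean value inequality applies with
  radius q/8. The factor 4^(j + 3) is the reciprocal of (q/8)^2.\<close>

lemma cusp_piece_pointwise_bound:
  assumes "decseq \<delta>" "\<And>s. 0 < \<delta> s" "\<And>s. \<delta> s \<le> 1 / 2" and hol: "F holomorphic_on unit_disk"
    and z: "z \<in> cusp_piece \<delta> j"
  shows "ennreal ((cmod (F z))\<^sup>2) \<le> ennreal (4 ^ (j + 3) / pi) * (\<integral>\<^sup>+w\<in>disk_strip j. ennreal ((cmod (F w))\<^sup>2) \<partial>lborel)"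
proof -
  let ?q = "(1 / 2 :: real) ^ j"
  have q: "0 < ?q" "?q \<le> 1" by (auto simp: power_le_one)
  have im: "\<bar>Im z\<bar> < \<delta> j * (1 / 2) ^ Suc j"
    using z by (intro cusp_domain_Im_bound assms) (auto simp: cusp_piece_def)
  also have "\<dots> \<le> 1 / 2 * (1 / 2) ^ Suc j"
    using assms(3) by (intro mult_right_mono) auto
  finally have im: "\<bar>Im z\<bar> < ?q / 4" by simp
  have re: "1 - ?q \<le> Re z" "Re z < 1 - ?q / 2" using z by (auto simp: cusp_piece_def)
  have nz: "cmod z < 1 - ?q / 4" using cmod_le[of z] im re q by linarith
  have sub: "ball z (?q / 4) \<subseteq> unit_disk"
  proof
    fix w assume "w \<in> ball z (?q / 4)"
    then show "w \<in> unit_disk" using nz norm_triangle_sub[of w z] by (simp add: dist_norm norm_minus_commute)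
  qed
  have sub2: "ball z (?q / 8) \<subseteq> disk_strip j"
  proof
    fix w assume w: "w \<in> ball z (?q / 8)"
    then have "w \<in> ball z (?q / 4)" using subset_ball[of "?q / 8" "?q / 4" z] q(1) by auto
    then have "w \<in> unit_disk" using sub by blast
    moreover have "\<bar>Re w - Re z\<bar> < ?q / 8"
      using w abs_Re_le_cmod[of "w - z"] by (simp add: dist_norm norm_minus_commute)
    moreover from this have "1 - 9 / 8 * ?q < Re w" "Re w < 1 - 3 / 8 * ?q" using re by linarith+
    ultimately show "w \<in> disk_strip j" by (simp add: disk_strip_def)
  qed
  have e: "4 ^ (j + 3) / pi * (pi * (?q / 8)\<^sup>2) = 1"
  proof -
    have "?q\<^sup>2 = (1 / 4) ^ j" by (simp add: power2_eq_square flip: power_mult_distrib)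
    then show ?thesis by (simp add: power_divide power_add)
  qed
  have "ennreal ((cmod (F z))\<^sup>2) = ennreal (4 ^ (j + 3) / pi) * ennreal (pi * (?q / 8)\<^sup>2 * (cmod (F z))\<^sup>2)"
    by (subst ennreal_mult[symmetric]) (use e in \<open>simp_all flip: mult.assoc\<close>)
  also have "ennreal (pi * (?q / 8)\<^sup>2 * (cmod (F z))\<^sup>2) \<le> (\<integral>\<^sup>+w\<in>ball z (?q / 8). ennreal ((cmod (F w))\<^sup>2) \<partial>lborel)"
    using holomorphic_on_subset[OF hol sub] q(1) by (intro holomorphic_area_submean_value[where R = "?q / 4"]) auto
  also have "\<dots> \<le> (\<integral>\<^sup>+w\<in>disk_strip j. ennreal ((cmod (F w))\<^sup>2) \<partial>lborel)"
    using sub2 by (intro nn_integral_mono) (auto split: split_indicator)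
  finally show ?thesis by (simp add: mult_left_mono)
qed

text \<open>If z lies in the strips i <= k, then 3/8 * 2^(-i) < 9/8 * 2^(-k), so 2^(k - i) < 3 and k
  <= i + 1. Hence no point lies in more than two strips.\<close>

lemma sum_indicator_disk_strip:
  "(\<Sum>j. indicator (disk_strip (J + j)) z :: ennreal) \<le> 2 * indicator unit_disk z"
proof (rule suminf_le_const)
  fix N
  show "(\<Sum>j<N. indicator (disk_strip (J + j)) z :: ennreal) \<le> 2 * indicator unit_disk z"
  proof -
    define K where "K = {j. j < N \<and> z \<in> disk_strip (J + j)}"
    have "K \<subseteq> {Min K, Suc (Min K)}" if ne: "K \<noteq> {}"
    proof
      fix k assume k: "k \<in> K"
      have fin: "finite K" by (auto simp: K_def)
      have m: "Min K \<in> K" using ne fin by simp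
      have le: "Min K \<le> k" using fin k by simp
      have "3 / 8 * (1 / 2) ^ (J + Min K) < 1 - Re z" "1 - Re z < 9 / 8 * (1 / 2) ^ (J + k)"
        using m k by (auto simp: K_def disk_strip_def)
      then have lt: "(1 / 2) ^ (J + Min K) < 3 * (1 / 2 :: real) ^ (J + k)" by simp
      have "k < Min K + 2"
      proof (rule ccontr)
        assume "\<not> k < Min K + 2"
        then have "(1 / 2 :: real) ^ (J + k) \<le> (1 / 2) ^ (J + Min K + 2)"
          by (intro power_decreasing) auto
        moreover have "(1 / 2 :: real) ^ (J + Min K + 2) = (1 / 2) ^ (J + Min K) / 4"
          by (simp add: power_add)
        moreover have "0 < (1 / 2 :: real) ^ (J + Min K)" by simp
        ultimately show False using lt by linarith
      qed
      with le show "k \<in> {Min K, Suc (Min K)}" by auto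
    qed
    then have "card K \<le> 2"
      using card_mono[of "{Min K, Suc (Min K)}" K] by (cases "K = {}") auto
    moreover have "(\<Sum>j<N. indicator (disk_strip (J + j)) z :: ennreal) = of_nat (card K)"
    proof -
      have "(\<Sum>j<N. indicator (disk_strip (J + j)) z :: ennreal) = (\<Sum>j\<in>K. 1)"
        by (rule sum.mono_neutral_cong_right) (auto simp: K_def indicator_def)
      then show ?thesis by simp
    qed
    moreover have "K = {}" if "z \<notin> unit_disk" using that by (auto simp: K_def disk_strip_def)
    moreover have "of_nat (card K) \<le> (of_nat 2 :: ennreal)" if "card K \<le> 2"
      using that by (simp only: of_nat_le_iff)
    ultimately show ?thesis by (auto simp: indicator_def)
  qed
qed simp

text \<open>On piece j the pointwise factor 4^(j + 3) / pi meets an area of at most 2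
  \<open>\<delta>\<close> 4^(-j - 1). The powers of 4 cancel and leave 32 \<open>\<delta>\<close> /
  pi at every scale; the double overlap of the strips turns 32 into 64.\<close>

lemma cusp_tail_bound:
  assumes \<delta>: "decseq \<delta>" "\<And>s. 0 < \<delta> s" "\<And>s. \<delta> s \<le> 1 / 2" and hol: "F holomorphic_on unit_disk"
  shows "(\<integral>\<^sup>+z\<in>cusp_domain \<delta> \<inter> {z. 1 - (1 / 2) ^ J \<le> Re z}. ennreal ((cmod (F z))\<^sup>2) \<partial>lborel)
    \<le> ennreal (64 / pi * \<delta> J) * (\<integral>\<^sup>+z\<in>unit_disk. ennreal ((cmod (F z))\<^sup>2) \<partial>lborel)"
proof -
  let ?g = "\<lambda>z. ennreal ((cmod (F z))\<^sup>2)"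
  let ?T = "cusp_domain \<delta> \<inter> {z. 1 - (1 / 2) ^ J \<le> Re z}"
  note contF = holomorphic_on_imp_continuous_on[OF hol]
  have mP: "(\<lambda>z. ?g z * indicator (cusp_piece \<delta> j) z) \<in> borel_measurable borel" for j
    using cusp_domain_subset_unit_disk[of \<delta>, OF \<delta>(3)]
    by (intro borel_measurable_norm_power2_on[OF contF]) (auto simp: cusp_piece_def)
  have mS: "(\<lambda>z. ?g z * indicator (disk_strip j) z) \<in> borel_measurable borel" for j
    by (intro borel_measurable_norm_power2_on[OF contF]) (auto simp: disk_strip_def)
  have cover: "\<exists>j. z \<in> cusp_piece \<delta> (J + j)" if z: "z \<in> ?T" for z
  proof -
    obtain s where "z \<in> cusp_box \<delta> s" using z by (auto simp: cusp_domain_def)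
    then have ex: "Re z < 1 - (1 / 2) ^ s" by (auto simp: cusp_box_def)
    \<comment> \<open>The first level that z does not reach comes after \<open>J\<close>, and z lies
      in the piece just before it.\<close>
    define n where "n = (LEAST s. Re z < 1 - (1 / 2) ^ s)"
    have n: "Re z < 1 - (1 / 2) ^ n" unfolding n_def by (rule LeastI[of _ s]) (rule ex)
    have nmin: "1 - (1 / 2) ^ k \<le> Re z" if "k < n" for k
      using not_less_Least[of k "\<lambda>s. Re z < 1 - (1 / 2) ^ s"] that by (auto simp: n_def)
    have "1 - (1 / 2) ^ J \<le> Re z" using z by blast
    then have "(1 / 2) ^ n < (1 / 2 :: real) ^ J" using n by linarith
    then have "J < n" by simp
    then have "z \<in> cusp_piece \<delta> (J + (n - J - 1))"
      using n nmin[of "n - 1"] z by (auto simp: cusp_piece_def Suc_diff_Suc)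
    then show ?thesis by blast
  qed
  have piece: "(\<integral>\<^sup>+z\<in>cusp_piece \<delta> (J + j). ?g z \<partial>lborel) \<le>
      ennreal (32 / pi * \<delta> J) * (\<integral>\<^sup>+z\<in>disk_strip (J + j). ?g z \<partial>lborel)" for j
  proof -
    let ?A = "\<integral>\<^sup>+z\<in>disk_strip (J + j). ?g z \<partial>lborel"
    let ?c = "4 ^ (J + j + 3) / pi"
    have "(\<integral>\<^sup>+z\<in>cusp_piece \<delta> (J + j). ?g z \<partial>lborel) \<le>
        (\<integral>\<^sup>+z\<in>cusp_piece \<delta> (J + j). ennreal ?c * ?A \<partial>lborel)"
      using cusp_piece_pointwise_bound[OF \<delta> hol]
      by (intro nn_integral_mono) (auto split: split_indicator)
    also have "\<dots> = ennreal ?c * ?A * emeasure lborel (cusp_piece \<delta> (J + j))"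
      by (intro nn_integral_cmult_indicator) simp
    also have "\<dots> \<le> ennreal ?c * ?A * ennreal (2 * \<delta> (J + j) * (1 / 4) ^ Suc (J + j))"
      by (intro mult_left_mono emeasure_cusp_piece \<delta>) auto
    also have "\<dots> = ennreal ?c * ennreal (2 * \<delta> (J + j) * (1 / 4) ^ Suc (J + j)) * ?A"
      by (simp add: mult_ac)
    also have "ennreal ?c * ennreal (2 * \<delta> (J + j) * (1 / 4) ^ Suc (J + j)) =
        ennreal (?c * (2 * \<delta> (J + j) * (1 / 4) ^ Suc (J + j)))"
      using \<delta>(2)[of "J + j"] by (intro ennreal_mult[symmetric]) auto
    also have "?c * (2 * \<delta> (J + j) * (1 / 4) ^ Suc (J + j)) = 32 / pi * \<delta> (J + j)"
      by (simp add: power_add power_divide)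
    also have "ennreal (32 / pi * \<delta> (J + j)) * ?A \<le> ennreal (32 / pi * \<delta> J) * ?A"
      using \<delta>(1) by (intro mult_right_mono ennreal_leI mult_left_mono) (auto simp: decseq_def)
    finally show ?thesis .
  qed
  have "(\<integral>\<^sup>+z\<in>?T. ?g z \<partial>lborel) \<le> (\<integral>\<^sup>+z. (\<Sum>j. ?g z * indicator (cusp_piece \<delta> (J + j)) z) \<partial>lborel)"
  proof (intro nn_integral_mono)
    fix z
    show "?g z * indicator ?T z \<le> (\<Sum>j. ?g z * indicator (cusp_piece \<delta> (J + j)) z)"
    proof (cases "z \<in> ?T")
      case True
      then obtain j where j: "z \<in> cusp_piece \<delta> (J + j)" using cover by blast
      have "(\<Sum>i\<in>{j}. ?g z * indicator (cusp_piece \<delta> (J + i)) z) \<le> (\<Sum>j. ?g z * indicator (cusp_piece \<delta> (J + j)) z)"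
        by (rule sum_le_suminf) auto
      then show ?thesis using True j by simp
    qed simp
  qed
  also have "\<dots> = (\<Sum>j. \<integral>\<^sup>+z\<in>cusp_piece \<delta> (J + j). ?g z \<partial>lborel)"
    using mP by (intro nn_integral_suminf) simp
  also have "\<dots> \<le> (\<Sum>j. ennreal (32 / pi * \<delta> J) * (\<integral>\<^sup>+z\<in>disk_strip (J + j). ?g z \<partial>lborel))"
    using piece by (intro suminf_le) auto
  also have "\<dots> = ennreal (32 / pi * \<delta> J) * (\<Sum>j. \<integral>\<^sup>+z\<in>disk_strip (J + j). ?g z \<partial>lborel)"
    by simp
  also have "(\<Sum>j. \<integral>\<^sup>+z\<in>disk_strip (J + j). ?g z \<partial>lborel) =
      (\<integral>\<^sup>+z. (\<Sum>j. ?g z * indicator (disk_strip (J + j)) z) \<partial>lborel)"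
    using mS by (intro nn_integral_suminf[symmetric]) simp
  also have "\<dots> \<le> (\<integral>\<^sup>+z. 2 * (?g z * indicator unit_disk z) \<partial>lborel)"
  proof (intro nn_integral_mono)
    fix z
    have "?g z * (\<Sum>j. indicator (disk_strip (J + j)) z) \<le> ?g z * (2 * indicator unit_disk z)"
      by (intro mult_left_mono sum_indicator_disk_strip) simp
    then show "(\<Sum>j. ?g z * indicator (disk_strip (J + j)) z) \<le> 2 * (?g z * indicator unit_disk z)"
      by (simp add: mult_ac)
  qed
  also have "\<dots> = 2 * (\<integral>\<^sup>+z\<in>unit_disk. ?g z \<partial>lborel)"
    by (intro nn_integral_cmult) (use borel_measurable_norm_power2_on[OF contF, of unit_disk] in simp)
  finally have "(\<integral>\<^sup>+z\<in>?T. ?g z \<partial>lborel) \<le> ennreal (32 / pi * \<delta> J) * (2 * (\<integral>\<^sup>+z\<in>unit_disk. ?g z \<partial>lborel))"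
    by (simp add: mult_left_mono)
  also have "\<dots> = ennreal (32 / pi * \<delta> J) * ennreal 2 * (\<integral>\<^sup>+z\<in>unit_disk. ?g z \<partial>lborel)"
    by (simp add: mult.assoc)
  also have "ennreal (32 / pi * \<delta> J) * ennreal 2 = ennreal (64 / pi * \<delta> J)"
    using \<delta>(2)[of J] by (subst ennreal_mult[symmetric]) auto
  finally show ?thesis .
qed

section \<open>Composition operators with univalent symbol\<close>


text \<open>Taken with respect to plain area: the factor 1/pi of the norm enters in
  \<open>norm_dirichlet_power2\<close>.\<close>

definition dirichlet_energy :: "complex set \<Rightarrow> (complex \<Rightarrow> complex) \<Rightarrow> real" where
  "dirichlet_energy S f = (LINT z:S|lborel. (cmod (deriv f z))\<^sup>2)"

lemma dirichlet_setD:
  assumes "f \<in> dirichlet_set"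
  shows "f holomorphic_on unit_disk" "deriv f holomorphic_on unit_disk"
    "continuous_on unit_disk (deriv f)"
proof -
  show "f holomorphic_on unit_disk" using assms by (simp add: dirichlet_set_def)
  then show "deriv f holomorphic_on unit_disk" by (intro holomorphic_deriv) auto
  then show "continuous_on unit_disk (deriv f)" by (rule holomorphic_on_imp_continuous_on)
qed

lemma set_integrable_norm_power2I:
  fixes F :: "complex \<Rightarrow> complex"
  assumes "continuous_on U F" "U \<in> sets borel" "S \<in> sets borel" "S \<subseteq> U"
    and fin: "(\<integral>\<^sup>+z\<in>S. ennreal ((cmod (F z))\<^sup>2) \<partial>lborel) < \<infinity>"
  shows "set_integrable lborel S (\<lambda>z. (cmod (F z))\<^sup>2)"
proof -
  let ?g = "\<lambda>z. indicator S z *\<^sub>R (cmod (F z))\<^sup>2"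
  have eq: "(\<lambda>z. ennreal (?g z)) = (\<lambda>z. ennreal ((cmod (F z))\<^sup>2) * indicator S z)"
    by (auto simp: fun_eq_iff split: split_indicator)
  have "(\<lambda>z. ennreal (?g z)) \<in> borel_measurable borel"
    unfolding eq by (rule borel_measurable_norm_power2_on[OF assms(1-4)])
  \<comment> \<open>Measurability of the real function is recovered from that of its extended
    version, since the values are nonnegative.\<close>
  then have "(\<lambda>z. enn2real (ennreal (?g z))) \<in> borel_measurable borel"
    by measurable
  then have m: "?g \<in> borel_measurable borel" by simp
  show ?thesis
    unfolding set_integrable_def
  proof (rule integrableI_nonneg)
    show "(\<integral>\<^sup>+z. ennreal (?g z) \<partial>lborel) < \<infinity>" unfolding eq by (rule fin)
  qed (use m in auto)
qed

lemma set_integrable_deriv_dirichlet: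
  assumes "f \<in> dirichlet_set" "S \<in> sets borel" "S \<subseteq> unit_disk"
  shows "set_integrable lborel S (\<lambda>z. (cmod (deriv f z))\<^sup>2)"
proof (rule set_integrable_subset)
  show "set_integrable lborel unit_disk (\<lambda>z. (cmod (deriv f z))\<^sup>2)"
    using assms(1) by (simp add: dirichlet_set_def)
qed (use assms in auto)

lemma ennreal_dirichlet_energy:
  assumes "f \<in> dirichlet_set" "S \<in> sets borel" "S \<subseteq> unit_disk"
  shows "ennreal (dirichlet_energy S f) = (\<integral>\<^sup>+z\<in>S. ennreal ((cmod (deriv f z))\<^sup>2) \<partial>lborel)"
proof -
  have "ennreal (dirichlet_energy S f) = (\<integral>\<^sup>+z. ennreal (indicator S z *\<^sub>R (cmod (deriv f z))\<^sup>2) \<partial>lborel)"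
    using set_integrable_deriv_dirichlet[OF assms]
    unfolding dirichlet_energy_def set_lebesgue_integral_def set_integrable_def
    by (intro nn_integral_eq_integral[symmetric]) auto
  also have "\<dots> = (\<integral>\<^sup>+z\<in>S. ennreal ((cmod (deriv f z))\<^sup>2) \<partial>lborel)"
    by (intro nn_integral_cong) (auto split: split_indicator)
  finally show ?thesis .
qed

lemma dirichlet_energy_nonneg: "0 \<le> dirichlet_energy S f"
  unfolding dirichlet_energy_def set_lebesgue_integral_def by (intro integral_nonneg_AE) auto

lemma dirichlet_energy_mono:
  assumes "f \<in> dirichlet_set" "S \<in> sets borel" "T \<in> sets borel" "S \<subseteq> T" "T \<subseteq> unit_disk"
  shows "dirichlet_energy S f \<le> dirichlet_energy T f"
proof -
  have "ennreal (dirichlet_energy S f) \<le> ennreal (dirichlet_energy T f)"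
    using assms by (subst (1 2) ennreal_dirichlet_energy) (auto intro!: nn_integral_mono split: split_indicator)
  then show ?thesis using dirichlet_energy_nonneg by (simp add: ennreal_le_iff)
qed

lemma norm_dirichlet_power2:
  "(norm f)\<^sup>2 = (cmod (dfun f 0))\<^sup>2 + dirichlet_energy unit_disk (dfun f) / pi"
  using dirichlet_energy_nonneg[of unit_disk "dfun f"]
  by (simp add: norm_dirichlet_def dirichlet_energy_def)

lemma dirichlet_energy_le_norm: "dirichlet_energy unit_disk (dfun f) \<le> pi * (norm f)\<^sup>2"
  by (simp add: norm_dirichlet_power2 field_simps)

text \<open>The submean value inequality for the derivative, on a disk of radius (1 - r)/2, half of
  a lower bound for the distance to the unit circle.\<close>

lemma cmod_deriv_dirichlet_le:
  assumes "cmod z \<le> r" "r < 1"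
  shows "cmod (deriv (dfun f) z) \<le> 2 / (1 - r) * norm f"
proof -
  let ?s = "(1 - r) / 2"
  note D = dfun[of f]
  have sub: "ball z (1 - r) \<subseteq> unit_disk"
  proof
    fix w assume "w \<in> ball z (1 - r)"
    then show "w \<in> unit_disk" using assms norm_triangle_sub[of w z] by (simp add: dist_norm norm_minus_commute)
  qed
  have "ennreal (pi * ?s\<^sup>2 * (cmod (deriv (dfun f) z))\<^sup>2) \<le>
      (\<integral>\<^sup>+w\<in>ball z ?s. ennreal ((cmod (deriv (dfun f) w))\<^sup>2) \<partial>lborel)"
    using assms by (intro holomorphic_area_submean_value[where R = "1 - r"]
        holomorphic_on_subset[OF dirichlet_setD(2)[OF D] sub]) auto
  also have "\<dots> \<le> (\<integral>\<^sup>+w\<in>unit_disk. ennreal ((cmod (deriv (dfun f) w))\<^sup>2) \<partial>lborel)"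
  proof -
    have "ball z ?s \<subseteq> ball z (1 - r)" using assms by (intro subset_ball) simp
    then have "ball z ?s \<subseteq> unit_disk" using sub by blast
    then show ?thesis by (intro nn_integral_mono) (simp add: indicator_def subset_iff)
  qed
  also have "\<dots> = ennreal (dirichlet_energy unit_disk (dfun f))"
    by (rule ennreal_dirichlet_energy[symmetric, OF D]) auto
  also have "\<dots> \<le> ennreal (pi * (norm f)\<^sup>2)"
    by (intro ennreal_leI dirichlet_energy_le_norm)
  finally have "pi * ?s\<^sup>2 * (cmod (deriv (dfun f) z))\<^sup>2 \<le> pi * (norm f)\<^sup>2"
    by (simp add: ennreal_le_iff)
  then have "(?s * cmod (deriv (dfun f) z))\<^sup>2 \<le> (norm f)\<^sup>2"
    by (simp only: power_mult_distrib) simp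
  then have "?s * cmod (deriv (dfun f) z) \<le> norm f"
    by (rule power2_le_imp_le) simp
  then show ?thesis using assms by (simp add: field_simps)
qed

lemma cmod_dirichlet_zero_le: "cmod (dfun f 0) \<le> norm f"
proof -
  have "(cmod (dfun f 0))\<^sup>2 \<le> (norm f)\<^sup>2"
    using dirichlet_energy_nonneg[of unit_disk "dfun f"] by (simp add: norm_dirichlet_power2)
  then show ?thesis by (rule power2_le_imp_le) simp
qed

text \<open>The norm controls the value at 0, and the derivative bound on the convex disk of radius
  \<open>r\<close> controls the increment. This local boundedness feeds Montel's theorem.\<close>

lemma cmod_dirichlet_le:
  assumes "cmod z \<le> r" "r < 1"
  shows "cmod (dfun f z) \<le> (1 + 2 / (1 - r)) * norm f"
proof -
  have "0 \<le> r" using assms(1) norm_ge_zero[of z] by linarith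
  have "cmod (dfun f z - dfun f 0) \<le> 2 / (1 - r) * norm f * cmod (z - 0)"
  proof (rule field_differentiable_bound[where S = "cball 0 r" and f' = "deriv (dfun f)"])
    fix w :: complex assume "w \<in> cball 0 r"
    then show "(dfun f has_field_derivative deriv (dfun f) w) (at w within cball 0 r)"
      using assms(2) dirichlet_setD(1)[OF dfun[of f]]
      by (intro has_field_derivative_at_within[OF holomorphic_derivI[of _ unit_disk]]) auto
    show "cmod (deriv (dfun f) w) \<le> 2 / (1 - r) * norm f"
      using \<open>w \<in> cball 0 r\<close> assms(2) by (intro cmod_deriv_dirichlet_le) auto
  qed (use assms \<open>0 \<le> r\<close> in auto)
  also have "\<dots> \<le> 2 / (1 - r) * norm f * 1"
    using assms by (intro mult_left_mono) auto
  finally have "cmod (dfun f z - dfun f 0) \<le> 2 / (1 - r) * norm f" by simp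
  moreover have "cmod (dfun f z) \<le> cmod (dfun f z - dfun f 0) + cmod (dfun f 0)"
    using norm_triangle_ineq[of "dfun f z - dfun f 0" "dfun f 0"] by simp
  ultimately show ?thesis using cmod_dirichlet_zero_le[of f] by (simp add: distrib_right)
qed

section \<open>Composition with an injective self-map of the disk\<close>

definition disk_compose :: "(complex \<Rightarrow> complex) \<Rightarrow> (complex \<Rightarrow> complex) \<Rightarrow> complex \<Rightarrow> complex" where
  "disk_compose \<phi> f = (\<lambda>z. if z \<in> unit_disk then f (\<phi> z) else 0)"

text \<open>\<open>Abs_dirichlet\<close> is meaningful here only if the composite lies in
  \<open>dirichlet_set\<close>; for injective symbols this is
  \<open>disk_compose_in_dirichlet_set\<close>.\<close>

definition dirichlet_compose :: "(complex \<Rightarrow> complex) \<Rightarrow> dirichlet \<Rightarrow> dirichlet" where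
  "dirichlet_compose \<phi> f = Abs_dirichlet (disk_compose \<phi> (dfun f))"

locale univalent_symbol =
  fixes \<phi> :: "complex \<Rightarrow> complex"
  assumes hol: "\<phi> holomorphic_on unit_disk"
    and inj: "inj_on \<phi> unit_disk"
    and maps: "\<phi> ` unit_disk \<subseteq> unit_disk"
begin

lemma image_borel: "\<phi> ` unit_disk \<in> sets borel"
  using open_mapping_thm3[OF hol _ inj] by simp

lemma disk_compose_holomorphic:
  assumes "f holomorphic_on unit_disk"
  shows "disk_compose \<phi> f holomorphic_on unit_disk"
proof -
  have "(f \<circ> \<phi>) holomorphic_on unit_disk"
    by (rule holomorphic_on_compose_gen[OF hol assms maps])
  then show ?thesis
    by (rule holomorphic_transform) (simp add: disk_compose_def)
qed

lemma deriv_disk_compose: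
  assumes f: "f holomorphic_on unit_disk" and z: "z \<in> unit_disk"
  shows "deriv (disk_compose \<phi> f) z = deriv f (\<phi> z) * deriv \<phi> z"
proof -
  have "\<phi> z \<in> unit_disk" using z maps by blast
  then have "((\<lambda>z. f (\<phi> z)) has_field_derivative deriv f (\<phi> z) * deriv \<phi> z) (at z)"
    using z by (intro DERIV_chain2[of f] holomorphic_derivI[OF f] holomorphic_derivI[OF hol]) auto
  then have "(disk_compose \<phi> f has_field_derivative deriv f (\<phi> z) * deriv \<phi> z) (at z)"
    by (rule has_field_derivative_transform_within_open[where S = unit_disk])
       (use z in \<open>auto simp: disk_compose_def\<close>)
  then show ?thesis by (rule DERIV_imp_deriv)
qed

text \<open>The chain rule produces the Jacobian factor |deriv \<open>\<phi>\<close>|^2, and by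
  injectivity the substitution counts every point of the image once.\<close>

lemma nn_integral_deriv_disk_compose:
  assumes f: "f holomorphic_on unit_disk"
  shows "(\<integral>\<^sup>+z\<in>unit_disk. ennreal ((cmod (deriv (disk_compose \<phi> f) z))\<^sup>2) \<partial>lborel) =
    (\<integral>\<^sup>+w\<in>\<phi> ` unit_disk. ennreal ((cmod (deriv f w))\<^sup>2) \<partial>lborel)"
proof -
  \<comment> \<open>The cutoff outside the disk makes the function measurable on the whole plane; at
    the values of \<open>\<phi>\<close> it changes nothing.\<close>
  let ?h = "\<lambda>w. ennreal ((cmod (deriv f w))\<^sup>2) * indicator unit_disk w"
  have m: "?h \<in> borel_measurable borel"
    using f by (intro borel_measurable_norm_power2_on[of unit_disk] holomorphic_on_imp_continuous_on holomorphic_deriv) auto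
  have "(\<integral>\<^sup>+z\<in>unit_disk. ennreal ((cmod (deriv (disk_compose \<phi> f) z))\<^sup>2) \<partial>lborel) =
      (\<integral>\<^sup>+z\<in>unit_disk. ?h (\<phi> z) * ennreal ((cmod (deriv \<phi> z))\<^sup>2) \<partial>lborel)"
  proof (intro nn_integral_cong)
    fix z
    show "ennreal ((cmod (deriv (disk_compose \<phi> f) z))\<^sup>2) * indicator unit_disk z =
        ?h (\<phi> z) * ennreal ((cmod (deriv \<phi> z))\<^sup>2) * indicator unit_disk z"
    proof (cases "z \<in> unit_disk")
      case True
      then have "\<phi> z \<in> unit_disk" using maps by blast
      with True show ?thesis
        by (simp add: deriv_disk_compose[OF f True] norm_mult power_mult_distrib ennreal_mult)
    qed simp
  qed
  also have "\<dots> = (\<integral>\<^sup>+w\<in>\<phi> ` unit_disk. ?h w \<partial>lborel)"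
    using m bounded_subset[OF bounded_ball maps]
    by (intro nn_integral_conformal_substitution hol inj) auto
  also have "\<dots> = (\<integral>\<^sup>+w\<in>\<phi> ` unit_disk. ennreal ((cmod (deriv f w))\<^sup>2) \<partial>lborel)"
    using maps by (intro nn_integral_cong) (auto split: split_indicator)
  finally show ?thesis .
qed

lemma disk_compose_in_dirichlet_set:
  assumes f: "f \<in> dirichlet_set"
  shows "disk_compose \<phi> f \<in> dirichlet_set"
proof -
  note holf = dirichlet_setD(1)[OF f]
  have "continuous_on unit_disk (deriv (disk_compose \<phi> f))"
    by (intro holomorphic_on_imp_continuous_on holomorphic_deriv disk_compose_holomorphic[OF holf]) auto
  moreover have "(\<integral>\<^sup>+z\<in>unit_disk. ennreal ((cmod (deriv (disk_compose \<phi> f) z))\<^sup>2) \<partial>lborel) < \<infinity>"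
    by (simp add: nn_integral_deriv_disk_compose[OF holf] flip: ennreal_dirichlet_energy[OF f image_borel maps])
  ultimately have "set_integrable lborel unit_disk (\<lambda>z. (cmod (deriv (disk_compose \<phi> f) z))\<^sup>2)"
    by (intro set_integrable_norm_power2I) auto
  then show ?thesis
    using disk_compose_holomorphic[OF holf] by (auto simp: dirichlet_set_def disk_compose_def)
qed

lemma dfun_dirichlet_compose: "dfun (dirichlet_compose \<phi> f) = disk_compose \<phi> (dfun f)"
  unfolding dirichlet_compose_def
  by (intro Abs_dirichlet_inverse disk_compose_in_dirichlet_set dfun)

lemma composition_op_dirichlet_compose: "composition_op \<phi> (dirichlet_compose \<phi>)"
  by (simp add: composition_op_def dfun_dirichlet_compose disk_compose_def)

lemma dirichlet_energy_compose:
  "dirichlet_energy unit_disk (dfun (dirichlet_compose \<phi> f)) = dirichlet_energy (\<phi> ` unit_disk) (dfun f)"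
proof -
  have "ennreal (dirichlet_energy unit_disk (dfun (dirichlet_compose \<phi> f))) =
      ennreal (dirichlet_energy (\<phi> ` unit_disk) (dfun f))"
    unfolding dfun_dirichlet_compose
    by (subst (1 2) ennreal_dirichlet_energy)
       (use image_borel maps dfun[of f] disk_compose_in_dirichlet_set[OF dfun[of f]]
          nn_integral_deriv_disk_compose[OF dirichlet_setD(1)[OF dfun[of f]]] in \<open>auto simp only: open_ball borel_open subset_refl\<close>)
  then show ?thesis using dirichlet_energy_nonneg by (simp add: ennreal_inj)
qed

lemma norm_dirichlet_compose_power2:
  "(norm (dirichlet_compose \<phi> f))\<^sup>2 =
     (cmod (dfun f (\<phi> 0)))\<^sup>2 + dirichlet_energy (\<phi> ` unit_disk) (dfun f) / pi"
  by (simp add: norm_dirichlet_power2 dirichlet_energy_compose)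
     (simp add: dfun_dirichlet_compose disk_compose_def)

lemma dirichlet_compose_add: "dirichlet_compose \<phi> (f + g) = dirichlet_compose \<phi> f + dirichlet_compose \<phi> g"
  by (rule dfun_inject[THEN iffD1]) (simp add: dfun_dirichlet_compose plus_dirichlet.rep_eq disk_compose_def fun_eq_iff)

lemma dirichlet_compose_scaleC: "dirichlet_compose \<phi> (scaleC c f) = scaleC c (dirichlet_compose \<phi> f)"
  by (rule dfun_inject[THEN iffD1]) (simp add: dfun_dirichlet_compose scaleC.rep_eq disk_compose_def fun_eq_iff)

lemma clinear_dirichlet_compose: "clinear_op (dirichlet_compose \<phi>)"
  unfolding Vector_Spaces.linear_iff
  by (intro conjI allI dirichlet.vector_space_axioms dirichlet_compose_add dirichlet_compose_scaleC)

lemma norm_dirichlet_compose_le: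
  "norm (dirichlet_compose \<phi> f) \<le> (2 + 2 / (1 - cmod (\<phi> 0))) * norm f"
proof -
  let ?r = "cmod (\<phi> 0)"
  have r: "?r < 1" using maps by (auto simp: image_subset_iff)
  have "dirichlet_energy (\<phi> ` unit_disk) (dfun f) \<le> dirichlet_energy unit_disk (dfun f)"
    by (intro dirichlet_energy_mono dfun image_borel maps) auto
  also have "\<dots> \<le> pi * (norm f)\<^sup>2" by (rule dirichlet_energy_le_norm)
  finally have "dirichlet_energy (\<phi> ` unit_disk) (dfun f) / pi \<le> (norm f)\<^sup>2" by (simp add: field_simps)
  moreover have "(cmod (dfun f (\<phi> 0)))\<^sup>2 \<le> ((1 + 2 / (1 - ?r)) * norm f)\<^sup>2"
    using r by (intro power_mono cmod_dirichlet_le) auto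
  ultimately have "(norm (dirichlet_compose \<phi> f))\<^sup>2 \<le> ((1 + 2 / (1 - ?r)) * norm f)\<^sup>2 + (1 * norm f)\<^sup>2"
    by (simp add: norm_dirichlet_compose_power2)
  also have "\<dots> \<le> ((1 + 2 / (1 - ?r)) * norm f + 1 * norm f)\<^sup>2"
    using r by (simp add: power2_sum)
  finally have "norm (dirichlet_compose \<phi> f) \<le> (1 + 2 / (1 - ?r)) * norm f + 1 * norm f"
    by (rule power2_le_imp_le) (use r in auto)
  then show ?thesis by (simp add: algebra_simps)
qed

lemma bounded_op_dirichlet_compose: "bounded_op (dirichlet_compose \<phi>)"
  unfolding bounded_op_def
proof
  show "bounded_linear (dirichlet_compose \<phi>)"
  proof (rule bounded_linear_intro)
    show "norm (dirichlet_compose \<phi> f) \<le> norm f * (2 + 2 / (1 - cmod (\<phi> 0)))" for f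
      using norm_dirichlet_compose_le[of f] by (simp only: mult.commute)
  qed (simp_all add: dirichlet_compose_add dirichlet_compose_scaleC scaleR_dirichlet_def)
qed (rule clinear_dirichlet_compose)

end

section \<open>Compactness\<close>


text \<open>Cauchy's inequality on circles of radius (1 - r)/2: they stay in a larger compact disk,
  on which the functions themselves are uniformly small.\<close>

lemma uniform_limit_deriv_zero:
  fixes h :: "nat \<Rightarrow> complex \<Rightarrow> complex"
  assumes hol: "\<And>n. h n holomorphic_on unit_disk"
    and lim: "\<And>K. compact K \<Longrightarrow> K \<subseteq> unit_disk \<Longrightarrow> uniform_limit K h (\<lambda>_. 0) sequentially"
    and r: "r < 1"
  shows "uniform_limit (cball 0 r) (\<lambda>n. deriv (h n)) (\<lambda>_. 0) sequentially"
proof (rule uniform_limitI)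
  fix e :: real assume e: "e > 0"
  define R where "R = (1 - r) / 2"
  have R: "R > 0" "r + R < 1" using r by (simp_all add: R_def field_simps)
  have "\<forall>\<^sub>F n in sequentially. \<forall>w\<in>cball 0 (r + R). dist (h n w) 0 < e / 2 * R"
  proof (rule uniform_limitD)
    show "uniform_limit (cball 0 (r + R)) h (\<lambda>_. 0) sequentially"
      using R by (intro lim) auto
  qed (use R e in auto)
  then show "\<forall>\<^sub>F n in sequentially. \<forall>z\<in>cball 0 r. dist (deriv (h n) z) 0 < e"
  proof eventually_elim
    case (elim n)
    show ?case
    proof
      fix z :: complex assume z: "z \<in> cball 0 r"
      have sub: "cball z R \<subseteq> cball 0 (r + R)"
      proof
        fix w assume "w \<in> cball z R"
        then show "w \<in> cball 0 (r + R)"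
          using z norm_triangle_sub[of w z] by (simp add: dist_norm norm_minus_commute)
      qed
      have sub': "cball z R \<subseteq> unit_disk" using sub R by force
      have "norm ((deriv ^^ 1) (h n) z) \<le> fact 1 * (e / 2 * R) / R ^ 1"
      proof (rule Cauchy_inequality)
        show "h n holomorphic_on ball z R"
          using hol[of n] sub' ball_subset_cball[of z R] by (blast intro: holomorphic_on_subset)
        show "continuous_on (cball z R) (h n)"
          using hol[of n] sub' by (blast intro: holomorphic_on_subset holomorphic_on_imp_continuous_on)
        fix x assume "cmod (z - x) = R"
        then have "x \<in> cball 0 (r + R)" using sub by (auto simp: dist_norm)
        then show "cmod (h n x) \<le> e / 2 * R" using elim by (auto simp: less_imp_le)
      qed (use R in auto)
      then show "dist (deriv (h n) z) 0 < e" using R e by simp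
    qed
  qed
qed

text \<open>Lower semicontinuity of the norm: Fatou's lemma bounds the Dirichlet integral of the
  limit and thereby also puts the limit into the space.\<close>

lemma dirichlet_fatou:
  fixes f :: "nat \<Rightarrow> dirichlet"
  assumes nf: "\<And>n. norm (f n) \<le> 1" and holg: "g holomorphic_on unit_disk"
    and g0: "\<And>z. z \<notin> unit_disk \<Longrightarrow> g z = 0"
    and lim0: "(\<lambda>n. dfun (f n) 0) \<longlonglongrightarrow> g 0"
    and lim': "\<And>z. z \<in> unit_disk \<Longrightarrow> (\<lambda>n. deriv (dfun (f n)) z) \<longlonglongrightarrow> deriv g z"
  obtains G where "dfun G = g" "norm G \<le> 1"
proof -
  let ?D = "\<lambda>h. \<integral>\<^sup>+z\<in>unit_disk. ennreal ((cmod (deriv h z))\<^sup>2) \<partial>lborel"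
  have contg: "continuous_on unit_disk (deriv g)"
    using holg by (intro holomorphic_on_imp_continuous_on holomorphic_deriv) auto
  have "?D g \<le> (\<integral>\<^sup>+z. liminf (\<lambda>n. ennreal ((cmod (deriv (dfun (f n)) z))\<^sup>2) * indicator unit_disk z) \<partial>lborel)"
  proof (intro nn_integral_mono)
    fix z :: complex
    have "liminf (\<lambda>n. ennreal ((cmod (deriv (dfun (f n)) z))\<^sup>2)) = ennreal ((cmod (deriv g z))\<^sup>2)"
      if "z \<in> unit_disk" by (intro lim_imp_Liminf tendsto_intros lim' that) simp
    then show "ennreal ((cmod (deriv g z))\<^sup>2) * indicator unit_disk z \<le>
       liminf (\<lambda>n. ennreal ((cmod (deriv (dfun (f n)) z))\<^sup>2) * indicator unit_disk z)"
      by (cases "z \<in> unit_disk") simp_all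
  qed
  also have "\<dots> \<le> liminf (\<lambda>n. ?D (dfun (f n)))"
    using borel_measurable_norm_power2_on[OF dirichlet_setD(3)[OF dfun], of unit_disk]
    by (intro nn_integral_liminf) simp
  \<comment> \<open>The value at 0 is kept under the liminf, so that both parts of the norm share
    one bound. Bounding them separately would only give norm at most sqrt 2.\<close>
  also have "\<dots> \<le> liminf (\<lambda>n. ennreal (pi - pi * (cmod (dfun (f n) 0))\<^sup>2))"
  proof (intro Liminf_mono always_eventually allI)
    fix n
    have eq: "?D (dfun (f n)) = ennreal (dirichlet_energy unit_disk (dfun (f n)))"
      by (rule ennreal_dirichlet_energy[symmetric, OF dfun]) auto
    have "(norm (f n))\<^sup>2 \<le> 1" using nf[of n] by (simp add: power_le_one)
    then have "dirichlet_energy unit_disk (dfun (f n)) \<le> pi - pi * (cmod (dfun (f n) 0))\<^sup>2"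
      by (simp add: norm_dirichlet_power2 field_simps)
    then have "ennreal (dirichlet_energy unit_disk (dfun (f n))) \<le> ennreal (pi - pi * (cmod (dfun (f n) 0))\<^sup>2)"
      by (rule ennreal_leI)
    then show "?D (dfun (f n)) \<le> ennreal (pi - pi * (cmod (dfun (f n) 0))\<^sup>2)" by (simp only: eq)
  qed
  also have "\<dots> = ennreal (pi - pi * (cmod (g 0))\<^sup>2)"
    by (intro lim_imp_Liminf tendsto_intros lim0) simp
  finally have le: "?D g \<le> ennreal (pi - pi * (cmod (g 0))\<^sup>2)" .
  have "set_integrable lborel unit_disk (\<lambda>z. (cmod (deriv g z))\<^sup>2)"
    by (rule set_integrable_norm_power2I[OF contg]) (use le in \<open>auto simp: le_less_trans\<close>)
  then have gd: "g \<in> dirichlet_set"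
    using holg g0 by (simp add: dirichlet_set_def)
  define G where "G = Abs_dirichlet g"
  have G: "dfun G = g" unfolding G_def by (rule Abs_dirichlet_inverse[OF gd])
  have "(cmod (g 0))\<^sup>2 \<le> 1"
  proof (rule LIMSEQ_le_const2)
    show "(\<lambda>n. (cmod (dfun (f n) 0))\<^sup>2) \<longlonglongrightarrow> (cmod (g 0))\<^sup>2" by (intro tendsto_intros lim0)
    have "cmod (dfun (f n) 0) \<le> 1" for n
      using nf[of n] cmod_dirichlet_zero_le[of "f n"] by linarith
    then show "\<exists>N. \<forall>n\<ge>N. (cmod (dfun (f n) 0))\<^sup>2 \<le> 1" by (auto simp: power_le_one)
  qed
  \<comment> \<open>This sign is needed to return from \<open>ennreal\<close>, where negative reals
    collapse to 0.\<close>
  then have "0 \<le> pi - pi * (cmod (g 0))\<^sup>2" by simp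
  moreover have "ennreal (dirichlet_energy unit_disk g) \<le> ennreal (pi - pi * (cmod (g 0))\<^sup>2)"
    using le by (subst ennreal_dirichlet_energy[OF gd]) auto
  ultimately have "dirichlet_energy unit_disk g \<le> pi - pi * (cmod (g 0))\<^sup>2"
    by (simp add: ennreal_le_iff)
  then have "(norm G)\<^sup>2 \<le> 1\<^sup>2"
    by (simp add: norm_dirichlet_power2 G field_simps)
  then have "norm G \<le> 1" by (rule power2_le_imp_le) simp
  with G show ?thesis by (rule that)
qed

lemma energy_le_of_deriv_bound:
  assumes "S \<in> sets borel" "S \<subseteq> unit_disk" "\<And>z. z \<in> S \<Longrightarrow> cmod (deriv (dfun f) z) \<le> \<eta>"
  shows "dirichlet_energy S (dfun f) \<le> pi * \<eta>\<^sup>2"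
proof -
  have "ennreal (dirichlet_energy S (dfun f)) = (\<integral>\<^sup>+z\<in>S. ennreal ((cmod (deriv (dfun f) z))\<^sup>2) \<partial>lborel)"
    by (rule ennreal_dirichlet_energy[OF dfun assms(1,2)])
  also have "\<dots> \<le> (\<integral>\<^sup>+z. ennreal (\<eta>\<^sup>2) * indicator unit_disk z \<partial>(lborel :: complex measure))"
    using assms(2,3) by (intro nn_integral_mono) (auto split: split_indicator intro!: ennreal_leI power_mono)
  also have "\<dots> = ennreal (\<eta>\<^sup>2) * ennreal pi"
    by (subst nn_integral_cmult_indicator) (simp_all add: emeasure_complex_ball)
  also have "\<dots> = ennreal (pi * \<eta>\<^sup>2)"
    by (simp add: ennreal_mult' mult.commute)
  finally show ?thesis by (simp add: ennreal_le_iff)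
qed

text \<open>Sequential compactness of the closed unit ball for locally uniform convergence: Montel's
  theorem supplies the limit, and Fatou's lemma keeps it in the ball.\<close>

lemma dirichlet_unit_ball_subsequence:
  fixes f :: "nat \<Rightarrow> dirichlet"
  assumes nf: "\<And>n. norm (f n) \<le> 1"
  obtains G r where "norm G \<le> 1" "strict_mono (r :: nat \<Rightarrow> nat)"
    "\<And>K. compact K \<Longrightarrow> K \<subseteq> unit_disk \<Longrightarrow> uniform_limit K (\<lambda>n. dfun (f (r n) - G)) (\<lambda>_. 0) sequentially"
proof -
  define H where "H = dfun ` cball 0 1"
  obtain g r where g: "g holomorphic_on unit_disk" and r: "strict_mono (r :: nat \<Rightarrow> nat)"
    and lim: "\<And>x. x \<in> unit_disk \<Longrightarrow> ((\<lambda>n. dfun (f (r n)) x) \<longlongrightarrow> g x) sequentially"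
    and unif: "\<And>K. \<lbrakk>compact K; K \<subseteq> unit_disk\<rbrakk> \<Longrightarrow> uniform_limit K ((\<lambda>n. dfun (f n)) \<circ> r) g sequentially"
  proof (rule Montel[of unit_disk H "\<lambda>n. dfun (f n)"])
    show "h holomorphic_on unit_disk" if "h \<in> H" for h
      using that dirichlet_setD(1)[OF dfun] by (auto simp: H_def)
    show "\<exists>B. \<forall>h\<in>H. \<forall>z\<in>K. norm (h z) \<le> B" if K: "compact K" "K \<subseteq> unit_disk" for K
    proof (cases "K = {}")
      case False
      \<comment> \<open>A point of largest modulus yields a single radius below 1 that serves all of
        \<open>K\<close>.\<close>
      obtain x where x: "x \<in> K" "\<And>y. y \<in> K \<Longrightarrow> cmod y \<le> cmod x"
        using continuous_attains_sup[OF K(1) False, of cmod] by (auto intro: continuous_intros)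
      have x1: "cmod x < 1" using x(1) K(2) by auto
      show ?thesis
      proof (intro exI ballI)
        fix h z assume h: "h \<in> H" and z: "z \<in> K"
        then obtain f' where f': "h = dfun f'" "norm f' \<le> 1" by (auto simp: H_def)
        have "cmod (h z) \<le> (1 + 2 / (1 - cmod x)) * norm f'"
          unfolding f'(1) using x(2)[OF z] x1 by (rule cmod_dirichlet_le)
        also have "\<dots> \<le> (1 + 2 / (1 - cmod x)) * 1"
          using f'(2) x1 by (intro mult_left_mono) auto
        finally show "cmod (h z) \<le> (1 + 2 / (1 - cmod x)) * 1" .
      qed
    qed simp
    show "range (\<lambda>n. dfun (f n)) \<subseteq> H" using nf by (auto simp: H_def)
  qed auto
  \<comment> \<open>The limit from Montel's theorem is arbitrary outside the disk, whereas elements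
    of the space vanish there.\<close>
  define g0 where "g0 = (\<lambda>z. if z \<in> unit_disk then g z else 0)"
  have holg0: "g0 holomorphic_on unit_disk"
    using g by (rule holomorphic_transform) (simp add: g0_def)
  have unif0: "uniform_limit K (\<lambda>n z. dfun (f (r n)) z - g0 z) (\<lambda>_. 0) sequentially"
    if K: "compact K" "K \<subseteq> unit_disk" for K
  proof (rule uniform_limitI)
    fix e :: real assume "e > 0"
    from uniform_limitD[OF unif[OF K] this]
    show "\<forall>\<^sub>F n in sequentially. \<forall>x\<in>K. dist (dfun (f (r n)) x - g0 x) 0 < e"
      by eventually_elim (use K(2) in \<open>auto simp: g0_def dist_norm subset_iff\<close>)
  qed
  have lim': "(\<lambda>n. deriv (dfun (f (r n))) z) \<longlonglongrightarrow> deriv g0 z" if z: "z \<in> unit_disk" for z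
  proof -
    have "uniform_limit (cball 0 (cmod z)) (\<lambda>n. deriv (\<lambda>z. dfun (f (r n)) z - g0 z)) (\<lambda>_. 0) sequentially"
      using z by (intro uniform_limit_deriv_zero unif0 holomorphic_on_diff dirichlet_setD(1) dfun holg0) auto
    then have "(\<lambda>n. deriv (\<lambda>z. dfun (f (r n)) z - g0 z) z) \<longlonglongrightarrow> 0"
      by (rule tendsto_uniform_limitI) simp
    moreover have "deriv (\<lambda>z. dfun (f (r n)) z - g0 z) z = deriv (dfun (f (r n))) z - deriv g0 z" for n
      using z dirichlet_setD(1)[OF dfun] holg0
      by (intro deriv_diff) (auto simp: holomorphic_on_open field_differentiable_def)
    ultimately show ?thesis by (simp add: LIM_zero_iff)
  qed
  obtain G where G: "dfun G = g0" "norm G \<le> 1"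
  proof (rule dirichlet_fatou[of "\<lambda>n. f (r n)" g0])
    show "(\<lambda>n. dfun (f (r n)) 0) \<longlonglongrightarrow> g0 0" using lim[of 0] by (simp add: g0_def)
  qed (use nf holg0 lim' in \<open>auto simp: g0_def\<close>)
  show ?thesis
    by (rule that[OF G(2) r]) (use unif0 in \<open>simp add: minus_dirichlet.rep_eq G(1)\<close>)
qed

section \<open>The composition operator of the cusp\<close>

locale cusp_symbol = univalent_symbol +
  fixes \<delta> :: "nat \<Rightarrow> real"
  assumes image: "\<phi> ` unit_disk = cusp_domain \<delta>"
    and dec: "decseq \<delta>" and pos: "\<And>s. 0 < \<delta> s" and half: "\<And>s. \<delta> s \<le> 1 / 2"
    and lim: "\<delta> \<longlonglongrightarrow> 0"
begin

lemma domain_subset: "cusp_domain \<delta> \<subseteq> unit_disk"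
  using half by (rule cusp_domain_subset_unit_disk)

lemma tail_energy_le:
  "dirichlet_energy (cusp_domain \<delta> \<inter> {z. 1 - (1 / 2) ^ J \<le> Re z}) (dfun f) \<le> 64 * \<delta> J * (norm f)\<^sup>2"
proof -
  let ?T = "cusp_domain \<delta> \<inter> {z. 1 - (1 / 2) ^ J \<le> Re z}"
  have T: "?T \<subseteq> unit_disk" using domain_subset by blast
  have Tb: "?T \<in> sets borel" by simp
  have p: "0 \<le> 64 / pi * \<delta> J" using pos[of J] by simp
  have "ennreal (dirichlet_energy ?T (dfun f)) \<le> ennreal (64 / pi * \<delta> J) * ennreal (dirichlet_energy unit_disk (dfun f))"
    unfolding ennreal_dirichlet_energy[OF dfun Tb T]
    using cusp_tail_bound[OF dec pos half dirichlet_setD(2)[OF dfun[of f]], of J]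
    by (simp add: ennreal_dirichlet_energy[OF dfun])
  also have "\<dots> = ennreal (64 / pi * \<delta> J * dirichlet_energy unit_disk (dfun f))"
    using p dirichlet_energy_nonneg by (intro ennreal_mult[symmetric])
  finally have "dirichlet_energy ?T (dfun f) \<le> 64 / pi * \<delta> J * dirichlet_energy unit_disk (dfun f)"
    using p dirichlet_energy_nonneg[of unit_disk "dfun f"]
    by (subst (asm) ennreal_le_iff) (rule mult_nonneg_nonneg)
  also have "\<dots> \<le> 64 / pi * \<delta> J * (pi * (norm f)\<^sup>2)"
    using p by (intro mult_left_mono dirichlet_energy_le_norm)
  finally show ?thesis by simp
qed

lemma energy_split:
  "dirichlet_energy (cusp_domain \<delta>) (dfun f) =
     dirichlet_energy (cusp_domain \<delta> \<inter> {z. c \<le> Re z}) (dfun f) +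
     dirichlet_energy (cusp_domain \<delta> \<inter> {z. Re z < c}) (dfun f)"
proof -
  have eq: "cusp_domain \<delta> = (cusp_domain \<delta> \<inter> {z. c \<le> Re z}) \<union> (cusp_domain \<delta> \<inter> {z. Re z < c})"
    by auto
  show ?thesis
    unfolding dirichlet_energy_def
    by (subst eq, rule set_integral_Un)
       (use domain_subset in \<open>auto intro!: set_integrable_deriv_dirichlet dfun\<close>)
qed

text \<open>The squared norm splits into the value at \<open>\<phi> 0\<close>, the energy in the
  tail and the energy in the rest, a third of e for each. The tail is handled first, by a choice of
  \<open>J\<close> uniform in n; for this fixed \<open>J\<close> the other two are small once n is
  large.\<close>

lemma dirichlet_compose_tendsto_zero:
  fixes h :: "nat \<Rightarrow> dirichlet"
  assumes bd: "\<And>n. norm (h n) \<le> B"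
    and unif: "\<And>K. compact K \<Longrightarrow> K \<subseteq> unit_disk \<Longrightarrow> uniform_limit K (\<lambda>n. dfun (h n)) (\<lambda>_. 0) sequentially"
  shows "(\<lambda>n. dirichlet_compose \<phi> (h n)) \<longlonglongrightarrow> 0"
proof -
  have "(\<lambda>n. (norm (dirichlet_compose \<phi> (h n)))\<^sup>2) \<longlonglongrightarrow> 0"
  proof (rule tendstoI)
    fix e :: real assume e: "e > 0"
    have "(\<lambda>J. 64 * \<delta> J * B\<^sup>2 / pi) \<longlonglongrightarrow> 64 * 0 * B\<^sup>2 / pi"
      by (intro tendsto_intros lim) simp
    then have "\<forall>\<^sub>F J in sequentially. 64 * \<delta> J * B\<^sup>2 / pi < e / 3"
      using e by (intro order_tendstoD(2)[of _ 0]) auto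
    then obtain J0 where J0: "\<And>J. J \<ge> J0 \<Longrightarrow> 64 * \<delta> J * B\<^sup>2 / pi < e / 3"
      by (auto simp: eventually_sequentially)
    \<comment> \<open>The successor ensures J >= 1, as \<open>cusp_domain_norm_bound\<close>
      requires.\<close>
    define J where "J = Suc J0"
    define \<eta> where "\<eta> = sqrt (e / 3)"
    have \<eta>: "\<eta> > 0" "\<eta>\<^sup>2 = e / 3" using e by (auto simp: \<eta>_def)
    have p0: "\<phi> 0 \<in> unit_disk" using maps by (auto simp: image_subset_iff)
    have "uniform_limit (cball 0 (1 - (1 / 2) ^ Suc J)) (\<lambda>n. deriv (dfun (h n))) (\<lambda>_. 0) sequentially"
      by (intro uniform_limit_deriv_zero unif dirichlet_setD dfun) auto
    then have ev1: "\<forall>\<^sub>F n in sequentially. \<forall>z\<in>cball 0 (1 - (1 / 2) ^ Suc J). dist (deriv (dfun (h n)) z) 0 < \<eta>"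
      using \<eta>(1) by (rule uniform_limitD)
    have "uniform_limit {\<phi> 0} (\<lambda>n. dfun (h n)) (\<lambda>_. 0) sequentially"
      using p0 by (intro unif) auto
    then have ev2: "\<forall>\<^sub>F n in sequentially. \<forall>z\<in>{\<phi> 0}. dist (dfun (h n) z) 0 < \<eta>"
      using \<eta>(1) by (rule uniform_limitD)
    from ev1 ev2 show "\<forall>\<^sub>F n in sequentially. dist ((norm (dirichlet_compose \<phi> (h n)))\<^sup>2) 0 < e"
    proof eventually_elim
      case (elim n)
      let ?E = "\<lambda>S. dirichlet_energy S (dfun (h n))"
      let ?c = "1 - (1 / 2) ^ J :: real"
      have 0: "64 * \<delta> J * B\<^sup>2 / pi < e / 3" by (rule J0) (simp add: J_def)
      have "(norm (h n))\<^sup>2 \<le> B\<^sup>2" using bd[of n] by (intro power_mono) auto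
      then have "64 * \<delta> J * (norm (h n))\<^sup>2 \<le> 64 * \<delta> J * B\<^sup>2"
        using pos[of J] by (intro mult_left_mono) auto
      then have "?E (cusp_domain \<delta> \<inter> {z. ?c \<le> Re z}) \<le> 64 * \<delta> J * B\<^sup>2"
        using tail_energy_le[of J "h n"] by linarith
      then have 1: "?E (cusp_domain \<delta> \<inter> {z. ?c \<le> Re z}) / pi \<le> 64 * \<delta> J * B\<^sup>2 / pi"
        by (intro divide_right_mono) auto
      have "?E (cusp_domain \<delta> \<inter> {z. Re z < ?c}) \<le> pi * \<eta>\<^sup>2"
      proof (rule energy_le_of_deriv_bound)
        show "cusp_domain \<delta> \<inter> {z. Re z < ?c} \<subseteq> unit_disk" using domain_subset by blast
        fix z assume "z \<in> cusp_domain \<delta> \<inter> {z. Re z < ?c}"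
        then have "z \<in> cball 0 (1 - (1 / 2) ^ Suc J)"
          using cusp_domain_norm_bound[of \<delta> z J, OF half] by (simp add: J_def)
        then show "cmod (deriv (dfun (h n)) z) \<le> \<eta>" using elim(1) by (auto simp: less_imp_le)
      qed simp
      then have 2: "?E (cusp_domain \<delta> \<inter> {z. Re z < ?c}) / pi \<le> \<eta>\<^sup>2" by (simp add: field_simps)
      have 3: "(cmod (dfun (h n) (\<phi> 0)))\<^sup>2 \<le> \<eta>\<^sup>2" using elim(2) by (intro power_mono) auto
      have "(norm (dirichlet_compose \<phi> (h n)))\<^sup>2 = (cmod (dfun (h n) (\<phi> 0)))\<^sup>2 +
          (?E (cusp_domain \<delta> \<inter> {z. ?c \<le> Re z}) / pi + ?E (cusp_domain \<delta> \<inter> {z. Re z < ?c}) / pi)"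
        by (simp add: norm_dirichlet_compose_power2 image energy_split[of "h n" ?c] add_divide_distrib)
      also have "\<dots> < e" using 0 1 2 3 \<eta>(2) by linarith
      finally show ?case by simp
    qed
  qed
  then have "(\<lambda>n. sqrt ((norm (dirichlet_compose \<phi> (h n)))\<^sup>2)) \<longlonglongrightarrow> sqrt 0"
    by (rule tendsto_real_sqrt)
  then show ?thesis by (simp add: tendsto_norm_zero_iff)
qed

lemma compact_op_dirichlet_compose: "compact_op (dirichlet_compose \<phi>)"
proof -
  interpret C: bounded_linear "dirichlet_compose \<phi>"
    using bounded_op_dirichlet_compose by (simp add: bounded_op_def)
  \<comment> \<open>The image is already compact, because the limit \<open>G\<close> of a
    subsequence again lies in the closed unit ball; the closure adds nothing.\<close>
  have "compact (dirichlet_compose \<phi> ` cball 0 1)"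
    unfolding compact_eq_seq_compact_metric seq_compact_def
  proof (intro allI impI)
    fix y :: "nat \<Rightarrow> dirichlet" assume "\<forall>n. y n \<in> dirichlet_compose \<phi> ` cball 0 1"
    then have "\<forall>n. \<exists>f. norm f \<le> 1 \<and> y n = dirichlet_compose \<phi> f"
      by (auto simp: image_iff Bex_def)
    then obtain f where f: "\<And>n. norm (f n) \<le> 1" "\<And>n. y n = dirichlet_compose \<phi> (f n)" by metis
    obtain G r where G: "norm G \<le> 1" and r: "strict_mono (r :: nat \<Rightarrow> nat)"
      and unif: "\<And>K. compact K \<Longrightarrow> K \<subseteq> unit_disk \<Longrightarrow>
          uniform_limit K (\<lambda>n. dfun (f (r n) - G)) (\<lambda>_. 0) sequentially"
      using dirichlet_unit_ball_subsequence[of f] f(1) by blast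
    have "(\<lambda>n. dirichlet_compose \<phi> (f (r n) - G)) \<longlonglongrightarrow> 0"
    proof (rule dirichlet_compose_tendsto_zero[OF _ unif])
      show "norm (f (r n) - G) \<le> 2" for n
        using norm_triangle_ineq4[of "f (r n)" G] f(1)[of "r n"] G by linarith
    qed
    then have "(y \<circ> r) \<longlonglongrightarrow> dirichlet_compose \<phi> G"
      by (simp add: C.diff f(2) LIM_zero_iff o_def)
    then show "\<exists>l\<in>dirichlet_compose \<phi> ` cball 0 1. \<exists>r. strict_mono r \<and> (y \<circ> r) \<longlonglongrightarrow> l"
      using G r by auto
  qed
  then show ?thesis
    using bounded_op_dirichlet_compose by (simp add: compact_op_def compact_imp_closed closure_closed)
qed

end

section \<open>Test functions\<close>


definition disk_power :: "nat \<Rightarrow> complex \<Rightarrow> complex" where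
  "disk_power m = (\<lambda>z. if z \<in> unit_disk then z ^ m else 0)"

definition monomial :: "nat \<Rightarrow> dirichlet" where
  "monomial m = Abs_dirichlet (disk_power m)"

lemma deriv_disk_power:
  assumes "z \<in> unit_disk"
  shows "deriv (disk_power m) z = of_nat m * z ^ (m - 1)"
proof -
  have "((\<lambda>z. z ^ m) has_field_derivative of_nat m * z ^ (m - 1)) (at z)"
    by (rule derivative_eq_intros refl | simp)+
  then have "(disk_power m has_field_derivative of_nat m * z ^ (m - 1)) (at z)"
    by (rule has_field_derivative_transform_within_open[where S = unit_disk])
       (use assms in \<open>auto simp: disk_power_def\<close>)
  then show ?thesis by (rule DERIV_imp_deriv)
qed

lemma disk_power_in_dirichlet_set: "disk_power m \<in> dirichlet_set"
proof -
  have "(\<lambda>z. z ^ m) holomorphic_on unit_disk" by (intro holomorphic_intros)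
  then have "disk_power m holomorphic_on unit_disk"
    by (rule holomorphic_transform) (simp add: disk_power_def)
  moreover have "set_integrable lborel unit_disk (\<lambda>z. (cmod (of_nat m * z ^ (m - 1)))\<^sup>2)"
    by (intro continuous_on_cball_imp_set_integrable_ball continuous_intros)
  then have "set_integrable lborel unit_disk (\<lambda>z. (cmod (deriv (disk_power m) z))\<^sup>2)"
    by (rule set_integrable_cong[THEN iffD1, rotated -1]) (simp_all add: deriv_disk_power)
  ultimately show ?thesis by (auto simp: dirichlet_set_def disk_power_def)
qed

lemma dfun_monomial: "dfun (monomial m) = disk_power m"
  unfolding monomial_def by (rule Abs_dirichlet_inverse[OF disk_power_in_dirichlet_set])

lemma deriv_dfun_scaleC:
  assumes "z \<in> unit_disk"
  shows "deriv (dfun (scaleC c f)) z = c * deriv (dfun f) z"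
  using dirichlet_deriv_scale[OF dfun assms] by (simp add: scaleC.rep_eq)

lemma deriv_dfun_sum:
  assumes "z \<in> unit_disk"
  shows "deriv (dfun (\<Sum>i\<in>A. f i)) z = (\<Sum>i\<in>A. deriv (dfun (f i)) z)"
proof (induction A rule: infinite_finite_induct)
  case (insert x A)
  then show ?case
    using dirichlet_deriv_add[OF dfun dfun assms] by (simp add: plus_dirichlet.rep_eq)
qed (simp_all add: zero_dirichlet.rep_eq)

lemma deriv_dfun_monomial:
  "z \<in> unit_disk \<Longrightarrow> deriv (dfun (monomial m)) z = of_nat m * z ^ (m - 1)"
  by (simp add: dfun_monomial deriv_disk_power)

lemma inner_eq_Re_mult_cnj: "inner x y = Re (x * cnj y)"
  by (simp add: inner_complex_def)

text \<open>\<open>inner\<close> is only the real part of the Hermitian product. Allowing arbitrary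
  complex \<open>a\<close> and \<open>b\<close> restores full Hermitian orthogonality, which complex
  linear combinations call for.\<close>

lemma inner_monomial:
  assumes "m \<noteq> k" "m \<ge> 1" "k \<ge> 1"
  shows "inner (scaleC a (monomial m)) (scaleC b (monomial k)) = 0"
proof -
  let ?c = "a * of_nat m * (cnj b * of_nat k)"
  let ?p = "\<lambda>z. z ^ (m - 1) * cnj z ^ (k - 1)"
  have int: "integrable lborel (\<lambda>z. indicator unit_disk z *\<^sub>R (?c * ?p z))"
    unfolding set_integrable_def[symmetric]
    by (intro continuous_on_cball_imp_set_integrable_ball continuous_intros)
  have "(LINT z:unit_disk|lborel. inner (deriv (dfun (scaleC a (monomial m))) z) (deriv (dfun (scaleC b (monomial k))) z))
      = (LINT z:unit_disk|lborel. Re (?c * ?p z))"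
    by (intro set_lebesgue_integral_cong)
       (auto simp: deriv_dfun_scaleC deriv_dfun_monomial inner_eq_Re_mult_cnj mult_ac)
  also have "\<dots> = (\<integral>z. Re (indicator unit_disk z *\<^sub>R (?c * ?p z)) \<partial>lborel)"
    unfolding set_lebesgue_integral_def by simp
  also have "\<dots> = Re (LINT z:unit_disk|lborel. ?c * ?p z)"
    unfolding set_lebesgue_integral_def by (rule integral_Re[OF int])
  also have "(LINT z:unit_disk|lborel. ?c * ?p z) = ?c * (LINT z:unit_disk|lborel. ?p z)"
    by simp
  also have "(LINT z:unit_disk|lborel. ?p z) = 0"
    using assms by (intro integral_monomials_orthogonal) auto
  finally have "(LINT z:unit_disk|lborel. inner (deriv (dfun (scaleC a (monomial m))) z)
      (deriv (dfun (scaleC b (monomial k))) z)) = 0" by simp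
  moreover have "dfun (scaleC a (monomial m)) 0 = 0"
    using assms by (simp add: scaleC.rep_eq dfun_monomial disk_power_def)
  ultimately show ?thesis by (simp add: inner_dirichlet_def)
qed

text \<open>The energy is |a|^2 m^2 times pi / m. With m >= 2 the exponent m - 1 has the form
  \<open>Suc k\<close> of \<open>nn_integral_norm_power_ball\<close>.\<close>

lemma norm_monomial:
  assumes "m \<ge> 2"
  shows "(norm (scaleC a (monomial m)))\<^sup>2 = (cmod a)\<^sup>2 * m"
proof -
  obtain k where k: "m = k + 2" using assms le_Suc_ex by (metis add.commute)
  have k': "m - 1 = Suc k" using k by simp
  let ?f = "scaleC a (monomial m)"
  have "ennreal (dirichlet_energy unit_disk (dfun ?f)) =
      (\<integral>\<^sup>+z\<in>unit_disk. ennreal ((cmod (deriv (dfun ?f) z))\<^sup>2) \<partial>lborel)"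
    by (rule ennreal_dirichlet_energy[OF dfun]) auto
  also have "\<dots> = (\<integral>\<^sup>+z. ennreal ((cmod a * m)\<^sup>2) * (ennreal (cmod z ^ (2 * Suc k)) * indicator unit_disk z) \<partial>lborel)"
  proof (intro nn_integral_cong)
    fix z :: complex
    show "ennreal ((cmod (deriv (dfun ?f) z))\<^sup>2) * indicator unit_disk z =
      ennreal ((cmod a * m)\<^sup>2) * (ennreal (cmod z ^ (2 * Suc k)) * indicator unit_disk z)"
    proof (cases "z \<in> unit_disk")
      case True
      have "(cmod (deriv (dfun ?f) z))\<^sup>2 = (cmod a * m)\<^sup>2 * (cmod z ^ Suc k)\<^sup>2"
        using True by (simp add: deriv_dfun_scaleC deriv_dfun_monomial norm_mult norm_power power_mult_distrib k'[simplified] del: power_Suc)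
      also have "(cmod z ^ Suc k)\<^sup>2 = cmod z ^ (2 * Suc k)"
        by (simp only: power_mult[symmetric] mult.commute)
      finally show ?thesis using True by (simp add: ennreal_mult del: power_Suc mult_Suc_right)
    qed simp
  qed
  also have "\<dots> = ennreal ((cmod a * m)\<^sup>2) * ennreal (pi / m)"
  proof (subst nn_integral_cmult)
    have [measurable]: "unit_disk \<in> sets borel" by simp
    show "(\<lambda>z. ennreal (cmod z ^ (2 * Suc k)) * indicator unit_disk z) \<in> borel_measurable lborel"
      by measurable
  qed (simp add: nn_integral_norm_power_ball k del: power_Suc mult_Suc_right)
  also have "\<dots> = ennreal ((cmod a * m)\<^sup>2 * (pi / m))"
    by (rule ennreal_mult[symmetric]) auto
  finally have "dirichlet_energy unit_disk (dfun ?f) = (cmod a * m)\<^sup>2 * (pi / m)"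
    using dirichlet_energy_nonneg[of unit_disk "dfun ?f"] by (subst (asm) ennreal_inj) auto
  then have "dirichlet_energy unit_disk (dfun ?f) / pi = (cmod a)\<^sup>2 * m"
    using assms by (simp add: power_mult_distrib power2_eq_square)
  moreover have "dfun ?f 0 = 0"
    using assms by (simp add: scaleC.rep_eq dfun_monomial disk_power_def)
  ultimately show ?thesis by (simp add: norm_dirichlet_power2)
qed

text \<open>The N monomials are orthogonal with squared norms between N and 2 N, so division by N
  keeps the norm bounded, while the slope at 1 - 1/N has order N. A single normalised monomial has
  slope of order sqrt N there, too little for a disk of radius about \<open>\<delta>\<close> /
  N.\<close>

definition freq_block :: "nat \<Rightarrow> dirichlet" where
  "freq_block N = scaleC (1 / of_nat N) (\<Sum>m\<in>{N<..2 * N}. monomial m)"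

text \<open>The derivative of \<open>freq_block N\<close> at a real point, by
  \<open>deriv_freq_block\<close>. Real test points in [0, 1) make all matrix entries real and
  nonnegative.\<close>

definition block_slope :: "nat \<Rightarrow> real \<Rightarrow> real" where
  "block_slope N y = (\<Sum>m\<in>{N<..2 * N}. real m * y ^ (m - 1)) / real N"

lemma scaleC_freq_block:
  "scaleC c (freq_block N) = (\<Sum>m\<in>{N<..2 * N}. scaleC (c / of_nat N) (monomial m))"
  by (simp add: freq_block_def dirichlet.scale_sum_right)

lemma inner_freq_block:
  assumes "2 * M \<le> N"
  shows "inner (scaleC a (freq_block M)) (scaleC b (freq_block N)) = 0"
  unfolding scaleC_freq_block inner_sum_left inner_sum_right
  using assms by (intro sum.neutral ballI inner_monomial) auto

lemma norm_freq_block_le: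
  assumes "N \<ge> 1"
  shows "(norm (scaleC c (freq_block N)))\<^sup>2 \<le> 2 * (cmod c)\<^sup>2"
proof -
  have "(norm (scaleC c (freq_block N)))\<^sup>2 = (\<Sum>m\<in>{N<..2 * N}. (norm (scaleC (c / of_nat N) (monomial m)))\<^sup>2)"
    unfolding scaleC_freq_block
    by (rule norm_sum_Pythagorean) (auto simp: pairwise_def orthogonal_def inner_monomial)
  also have "\<dots> \<le> (\<Sum>m\<in>{N<..2 * N}. (cmod c / N)\<^sup>2 * (2 * N))"
  proof (rule sum_mono)
    fix m assume m: "m \<in> {N<..2 * N}"
    then have "(norm (scaleC (c / of_nat N) (monomial m)))\<^sup>2 = (cmod c / N)\<^sup>2 * m"
      using assms by (subst norm_monomial) (auto simp: norm_divide)
    also have "\<dots> \<le> (cmod c / N)\<^sup>2 * (2 * N)"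
      using m by (intro mult_left_mono) (auto simp: of_nat_le_iff simp del: of_nat_mult)
    finally show "(norm (scaleC (c / of_nat N) (monomial m)))\<^sup>2 \<le> (cmod c / N)\<^sup>2 * (2 * N)" .
  qed
  also have "\<dots> = 2 * (cmod c)\<^sup>2"
    using assms by (simp add: power2_eq_square)
  finally show ?thesis .
qed

lemma deriv_freq_block:
  assumes "\<bar>y\<bar> < 1"
  shows "deriv (dfun (freq_block N)) (of_real y) = of_real (block_slope N y)"
  using assms
  by (simp add: freq_block_def deriv_dfun_scaleC deriv_dfun_sum deriv_dfun_monomial block_slope_def)

lemma block_slope_nonneg: "0 \<le> y \<Longrightarrow> 0 \<le> block_slope N y"
  by (auto simp: block_slope_def intro!: divide_nonneg_nonneg sum_nonneg)

lemma block_slope_le: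
  assumes "0 \<le> y" "y \<le> 1" "N \<ge> 1"
  shows "block_slope N y \<le> 2 * N * y ^ N"
proof -
  have "(\<Sum>m\<in>{N<..2 * N}. real m * y ^ (m - 1)) \<le> (\<Sum>m\<in>{N<..2 * N}. 2 * real N * y ^ N)"
  proof (rule sum_mono)
    fix m assume m: "m \<in> {N<..2 * N}"
    then have "real m \<le> real (2 * N)" by (simp only: of_nat_le_iff) simp
    then show "real m * y ^ (m - 1) \<le> 2 * real N * y ^ N"
      using assms m by (intro mult_mono power_decreasing) auto
  qed
  then show ?thesis using assms by (simp add: block_slope_def divide_le_eq mult_ac)
qed

lemma block_slope_ge:
  assumes "0 \<le> y" "y \<le> 1" "N \<ge> 1"
  shows "N * y ^ (2 * N) \<le> block_slope N y"
proof -
  have "(\<Sum>m\<in>{N<..2 * N}. real N * y ^ (2 * N)) \<le> (\<Sum>m\<in>{N<..2 * N}. real m * y ^ (m - 1))"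
    using assms by (intro sum_mono mult_mono power_decreasing) auto
  then show ?thesis using assms by (simp add: block_slope_def le_divide_eq mult_ac)
qed

text \<open>With an even frequency Bernoulli's inequality gives (1 - 1/(2N))^N >= 1/2. The exponent
  4 N from \<open>block_slope_ge\<close> then yields (1/2)^4 = 1/16.\<close>

lemma block_slope_diag:
  assumes "N \<ge> 1"
  shows "1 / 16 \<le> block_slope (2 * N) (1 - 1 / (2 * real N)) / (2 * real N)"
proof -
  let ?y = "1 - 1 / (2 * real N)"
  have y: "0 \<le> ?y" "?y \<le> 1" using assms by (auto simp: field_simps)
  have "1 + real N * (- 1 / (2 * real N)) \<le> (1 + (- 1 / (2 * real N))) ^ N"
    using y by (intro Bernoulli_inequality) auto
  then have "1 / 2 \<le> ?y ^ N" using assms by simp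
  then have "(1 / 2) ^ 4 \<le> (?y ^ N) ^ 4" by (intro power_mono) auto
  then have "1 / 16 \<le> ?y ^ (2 * (2 * N))" by (simp add: power_divide mult.commute flip: power_mult)
  also have "\<dots> \<le> block_slope (2 * N) ?y / (2 * real N)"
    using block_slope_ge[of ?y "2 * N"] y assms by (simp add: field_simps)
  finally show ?thesis .
qed

text \<open>Meant for frequencies \<open>M\<close> far below \<open>N\<close>, where bounding powers
  by 1 loses little. The factor 2 is relaxed to 4 to agree with
  \<open>block_slope_high\<close>.\<close>

lemma block_slope_low:
  assumes "0 \<le> y" "y \<le> 1" "M \<ge> 1"
  shows "block_slope M y / N \<le> 4 * (real M / real N)"
proof -
  have "block_slope M y \<le> 2 * real M * y ^ M" by (rule block_slope_le) fact+
  also have "\<dots> \<le> 2 * real M * 1" using assms by (intro mult_left_mono power_le_one) auto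
  finally have "block_slope M y / N \<le> 2 * real M / N" by (intro divide_right_mono) auto
  also have "\<dots> \<le> 4 * real M / N" by (intro divide_right_mono) auto
  finally show ?thesis by simp
qed

text \<open>Meant for frequencies \<open>M\<close> far above \<open>N\<close>. With q = M/N the
  power is at most exp(-q), and exp q >= q^2 / 2 beats the factor 2 q, which leaves 4 / q.\<close>

lemma block_slope_high:
  assumes "M \<ge> 1" "N \<ge> 1"
  shows "block_slope M (1 - 1 / real N) / N \<le> 4 * (real N / real M)"
proof -
  let ?y = "1 - 1 / real N" and ?q = "real M / real N"
  have y: "0 \<le> ?y" "?y \<le> 1" using assms by (auto simp: field_simps)
  have q: "?q > 0" using assms by simp
  have "?y \<le> exp (- 1 / real N)" using exp_ge_add_one_self[of "- 1 / real N"] by simp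
  then have "?y ^ M \<le> exp (- 1 / real N) ^ M" using y by (intro power_mono)
  also have "\<dots> = exp (- ?q)" by (simp add: exp_of_nat_mult[symmetric])
  also have "\<dots> \<le> 2 / ?q\<^sup>2"
  proof -
    have "?q\<^sup>2 / 2 \<le> exp ?q" using exp_lower_Taylor_quadratic[of ?q] q by simp
    then have "inverse (exp ?q) \<le> inverse (?q\<^sup>2 / 2)" using q assms by (intro le_imp_inverse_le) auto
    then show ?thesis by (simp add: exp_minus)
  qed
  finally have "2 * ?q * ?y ^ M \<le> 2 * ?q * (2 / ?q\<^sup>2)" using q by (intro mult_left_mono) auto
  also have "\<dots> = 4 * (real N / real M)" using assms by (simp add: power2_eq_square)
  finally have "2 * ?q * ?y ^ M \<le> 4 * (real N / real M)" .
  moreover have "block_slope M ?y / N \<le> 2 * real M * ?y ^ M / N"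
    using y assms by (intro divide_right_mono block_slope_le) auto
  ultimately show ?thesis by simp
qed

section \<open>Lower bounds on the test functions\<close>


text \<open>Schur's test: row and column sums of at most 1/32 bound the Euclidean operator norm of
  \<open>Q\<close> by 1/32, half of the lower bound 1/16 on the diagonal. What remains is 1/32, and
  its square is 1/1024.\<close>

lemma dominant_diagonal_lower_bound:
  fixes c :: "nat \<Rightarrow> complex" and d :: "nat \<Rightarrow> real" and Q :: "nat \<Rightarrow> nat \<Rightarrow> real"
  assumes Q: "\<And>j k. 0 \<le> Q j k" and d: "\<And>j. 1 / 16 \<le> d j"
    and row: "\<And>j. j < n \<Longrightarrow> (\<Sum>k<n. Q j k) \<le> 1 / 32"
    and col: "\<And>k. k < n \<Longrightarrow> (\<Sum>j<n. Q j k) \<le> 1 / 32"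
  shows "(\<Sum>j<n. (cmod (c j))\<^sup>2) / 1024 \<le> (\<Sum>j<n. (cmod (c j * d j + (\<Sum>k<n. c k * Q j k)))\<^sup>2)"
proof -
  define v where "v = (\<lambda>j. cmod (c j * d j + (\<Sum>k<n. c k * Q j k)))"
  define w where "w = (\<lambda>j. \<Sum>k<n. Q j k * cmod (c k))"
  \<comment> \<open>Splitting \<open>Q j k\<close> into two square roots lets Cauchy-Schwarz bring
    in the row sums; the column sums enter afterwards, when the order of summation is
    exchanged.\<close>
  have w2: "(w j)\<^sup>2 \<le> 1 / 32 * (\<Sum>k<n. Q j k * (cmod (c k))\<^sup>2)" if j: "j < n" for j
  proof -
    have "(w j)\<^sup>2 = (\<Sum>k<n. sqrt (Q j k) * (sqrt (Q j k) * cmod (c k)))\<^sup>2"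
      using Q by (simp add: w_def mult.assoc[symmetric])
    also have "\<dots> \<le> (\<Sum>k<n. (sqrt (Q j k))\<^sup>2) * (\<Sum>k<n. (sqrt (Q j k) * cmod (c k))\<^sup>2)"
      by (rule Cauchy_Schwarz_ineq_sum)
    also have "\<dots> = (\<Sum>k<n. Q j k) * (\<Sum>k<n. Q j k * (cmod (c k))\<^sup>2)"
      using Q by (simp add: power_mult_distrib)
    also have "\<dots> \<le> 1 / 32 * (\<Sum>k<n. Q j k * (cmod (c k))\<^sup>2)"
      using Q by (intro mult_right_mono row j sum_nonneg) auto
    finally show ?thesis .
  qed
  have "(\<Sum>j<n. (w j)\<^sup>2) \<le> (\<Sum>j<n. 1 / 32 * (\<Sum>k<n. Q j k * (cmod (c k))\<^sup>2))"
    using w2 by (intro sum_mono) auto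
  also have "\<dots> = 1 / 32 * (\<Sum>k<n. (\<Sum>j<n. Q j k) * (cmod (c k))\<^sup>2)"
    unfolding sum_distrib_left[symmetric] sum_distrib_right by (subst sum.swap) (rule refl)
  also have "\<dots> \<le> 1 / 32 * (\<Sum>k<n. 1 / 32 * (cmod (c k))\<^sup>2)"
    using col by (intro mult_left_mono sum_mono mult_right_mono) auto
  finally have W: "(\<Sum>j<n. (w j)\<^sup>2) \<le> (\<Sum>k<n. (cmod (c k))\<^sup>2) / 1024"
    by (simp flip: sum_distrib_left sum_divide_distrib)
  have "(cmod (c j))\<^sup>2 / 256 \<le> 2 * (v j)\<^sup>2 + 2 * (w j)\<^sup>2" for j
  proof -
    have "1 / 16 * cmod (c j) \<le> d j * cmod (c j)" using d by (intro mult_right_mono) auto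
    also have "\<dots> = cmod (c j * d j)" using d[of j] by (simp add: norm_mult)
    also have "\<dots> \<le> v j + cmod (\<Sum>k<n. c k * Q j k)"
      unfolding v_def using norm_triangle_ineq4[of "c j * d j + (\<Sum>k<n. c k * Q j k)" "\<Sum>k<n. c k * Q j k"] by simp
    also have "cmod (\<Sum>k<n. c k * Q j k) \<le> w j"
      unfolding w_def using Q by (intro sum_norm_le) (simp add: norm_mult mult.commute)
    finally have "cmod (c j) / 16 \<le> v j + w j" by simp
    then have "(cmod (c j) / 16)\<^sup>2 \<le> (v j + w j)\<^sup>2" by (intro power_mono) auto
    also have "\<dots> \<le> 2 * (v j)\<^sup>2 + 2 * (w j)\<^sup>2"
      using sum_squares_bound[of "v j" "w j"] by (simp add: power2_sum)
    finally show ?thesis by (simp add: power_divide)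
  qed
  then have "(\<Sum>j<n. (cmod (c j))\<^sup>2 / 256) \<le> (\<Sum>j<n. 2 * (v j)\<^sup>2 + 2 * (w j)\<^sup>2)"
    by (intro sum_mono)
  then have "(\<Sum>j<n. (cmod (c j))\<^sup>2) / 256 \<le> 2 * (\<Sum>j<n. (v j)\<^sup>2) + 2 * (\<Sum>j<n. (w j)\<^sup>2)"
    by (simp add: sum.distrib sum_divide_distrib sum_distrib_left)
  with W show ?thesis unfolding v_def by linarith
qed

text \<open>With truncated subtraction, \<open>(j - k) + (k - j)\<close> is |j - k|. Each side of
  \<open>j\<close> contributes a geometric sum of at most 1/1023, so the total is at most
  8/1023.\<close>

lemma sum_power_distance_le:
  assumes "j < n"
  shows "(\<Sum>k<n. if k = j then 0 else 4 * (1 / 1024) ^ ((j - k) + (k - j))) \<le> (1 / 32 :: real)"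
proof -
  let ?b = "1 / 1024 :: real"
  have geo: "(\<Sum>i\<in>{1..m}. ?b ^ i) \<le> 1 / 1023" for m
  proof -
    have "1023 * (\<Sum>i\<in>{1..m}. ?b ^ i) = 1 - ?b ^ m"
      by (induction m) (simp_all add: distrib_left)
    moreover have "0 \<le> ?b ^ m" by simp
    ultimately show ?thesis by linarith
  qed
  have "(\<Sum>k<n. if k = j then 0 else 4 * ?b ^ ((j - k) + (k - j))) =
      (\<Sum>k\<in>{..<j} \<union> {j<..<n}. 4 * ?b ^ ((j - k) + (k - j)))"
    using assms by (intro sum.mono_neutral_cong_right) auto
  also have "\<dots> = (\<Sum>k\<in>{..<j}. 4 * ?b ^ (j - k)) + (\<Sum>k\<in>{j<..<n}. 4 * ?b ^ (k - j))"
    by (subst sum.union_disjoint) auto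
  also have "(\<Sum>k\<in>{..<j}. 4 * ?b ^ (j - k)) = 4 * (\<Sum>i\<in>{1..j}. ?b ^ i)"
    unfolding sum_distrib_left
    by (rule sum.reindex_bij_witness[of _ "\<lambda>i. j - i" "\<lambda>k. j - k"]) auto
  also have "(\<Sum>k\<in>{j<..<n}. 4 * ?b ^ (k - j)) = 4 * (\<Sum>i\<in>{1..n - j - 1}. ?b ^ i)"
    unfolding sum_distrib_left
    by (rule sum.reindex_bij_witness[of _ "\<lambda>i. j + i" "\<lambda>k. k - j"]) auto
  also have "4 * (\<Sum>i\<in>{1..j}. ?b ^ i) + 4 * (\<Sum>i\<in>{1..n - j - 1}. ?b ^ i) \<le> 1 / 32"
    using geo[of j] geo[of "n - j - 1"] by linarith
  finally show ?thesis .
qed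

text \<open>For s = 10 * Suc k this is 2^(s - 1), so that \<open>test_point k\<close> is 1 - 2 *
  (1/2)^s, the centre of a disk from \<open>ball_subset_cusp_domain\<close>. The ratio 1024 of
  neighbours keeps the off-diagonal sums small.\<close>

definition test_freq :: "nat \<Rightarrow> nat" where
  "test_freq k = 512 * 1024 ^ k"

definition test_point :: "nat \<Rightarrow> real" where
  "test_point k = 1 - 1 / test_freq k"

definition test_fun :: "nat \<Rightarrow> (nat \<Rightarrow> complex) \<Rightarrow> dirichlet" where
  "test_fun n c = (\<Sum>k<n. scaleC (c k) (freq_block (test_freq k)))"

lemma test_freq_ge: "512 \<le> test_freq k"
  by (simp add: test_freq_def)

lemma test_freq_pos: "0 < real (test_freq k)" "1 \<le> test_freq k"
  using test_freq_ge[of k] by auto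

lemma half_power_test_freq: "(1 / 2) ^ (10 * Suc k) = 1 / (2 * real (test_freq k))"
proof -
  have "(1 / 2 :: real) ^ (10 * Suc k) = ((1 / 2) ^ 10) ^ Suc k" by (rule power_mult)
  also have "(1 / 2 :: real) ^ 10 = 1 / 1024" by (simp add: power_divide)
  finally show ?thesis by (simp add: test_freq_def power_divide)
qed

lemma test_freq_ratio:
  assumes "j \<le> k"
  shows "real (test_freq j) / real (test_freq k) = (1 / 1024) ^ (k - j)"
  using assms by (simp add: test_freq_def power_diff power_divide)

lemma test_freq_gap:
  assumes "j < k"
  shows "1024 * test_freq j \<le> test_freq k"
proof -
  have "(1024 :: nat) ^ Suc j \<le> 1024 ^ k" using assms by (intro power_increasing) auto
  then show ?thesis by (simp add: test_freq_def)
qed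

lemma test_point_bounds: "0 \<le> test_point k" "test_point k < 1"
  using test_freq_ge[of k] by (auto simp: test_point_def field_simps)

lemma norm_test_fun_le: "(norm (test_fun n c))\<^sup>2 \<le> 2 * (\<Sum>k<n. (cmod (c k))\<^sup>2)"
proof -
  have orth: "inner (scaleC a (freq_block (test_freq j))) (scaleC b (freq_block (test_freq k))) = 0"
    if "j < k" for a b j k
    using test_freq_gap[OF that] by (intro inner_freq_block) auto
  have "(norm (test_fun n c))\<^sup>2 = (\<Sum>k<n. (norm (scaleC (c k) (freq_block (test_freq k))))\<^sup>2)"
    unfolding test_fun_def
  proof (rule norm_sum_Pythagorean)
    show "pairwise (\<lambda>i j. orthogonal (scaleC (c i) (freq_block (test_freq i)))
        (scaleC (c j) (freq_block (test_freq j)))) {..<n}"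
      unfolding pairwise_def orthogonal_def by (metis orth inner_commute linorder_neqE_nat)
  qed simp
  also have "\<dots> \<le> (\<Sum>k<n. 2 * (cmod (c k))\<^sup>2)"
    by (intro sum_mono norm_freq_block_le test_freq_pos)
  finally show ?thesis by (simp add: sum_distrib_left)
qed

text \<open>Coefficients are mapped to slopes at the test points, the j-th slope being divided by
  \<open>test_freq j\<close>. The matrix of this map has diagonal entries at least 1/16 and
  off-diagonal entries at most 4 * 1024^(-|j - k|), so the diagonal dominates.\<close>

lemma deriv_test_fun_lower_bound:
  "(\<Sum>j<n. (cmod (c j))\<^sup>2) / 1024 \<le>
    (\<Sum>j<n. (cmod (deriv (dfun (test_fun n c)) (of_real (test_point j))))\<^sup>2 / (real (test_freq j))\<^sup>2)"
proof -
  define M where "M = (\<lambda>j k. block_slope (test_freq k) (test_point j) / test_freq j)"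
  define Q where "Q = (\<lambda>j k. if k = j then 0 else M j k)"
  have M0: "0 \<le> M j k" for j k
    unfolding M_def by (intro divide_nonneg_nonneg block_slope_nonneg test_point_bounds) auto
  \<comment> \<open>\<open>256 * 1024 ^ j\<close> is half of \<open>test_freq j\<close>, since
    \<open>block_slope_diag\<close> doubles its argument.\<close>
  have diag: "1 / 16 \<le> M j j" for j
    using block_slope_diag[of "256 * 1024 ^ j"] by (simp add: M_def test_point_def test_freq_def)
  have Qle: "Q j k \<le> (if k = j then 0 else 4 * (1 / 1024) ^ ((j - k) + (k - j)))" for j k
  proof -
    consider "k = j" | "k < j" | "j < k" by linarith
    then show ?thesis
    proof cases
      case 2
      have "M j k \<le> 4 * (real (test_freq k) / real (test_freq j))"
        unfolding M_def using test_point_bounds[of j] test_freq_pos by (intro block_slope_low) auto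
      then show ?thesis using 2 by (simp add: Q_def test_freq_ratio)
    next
      case 3
      have "M j k \<le> 4 * (real (test_freq j) / real (test_freq k))"
        unfolding M_def test_point_def using test_freq_pos by (intro block_slope_high) auto
      then show ?thesis using 3 by (simp add: Q_def test_freq_ratio)
    qed (simp add: Q_def)
  qed
  have row: "(\<Sum>k<n. Q j k) \<le> 1 / 32" if "j < n" for j
    by (rule order_trans[OF sum_mono[OF Qle] sum_power_distance_le[OF that]])
  have col: "(\<Sum>j<n. Q j k) \<le> 1 / 32" if "k < n" for k
  proof -
    have "(\<Sum>j<n. Q j k) \<le> (\<Sum>j<n. if j = k then 0 else 4 * (1 / 1024) ^ ((k - j) + (j - k)))"
      by (intro sum_mono order_trans[OF Qle]) (simp add: add.commute)
    then show ?thesis using sum_power_distance_le[OF that] by (rule order_trans)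
  qed
  have eq: "deriv (dfun (test_fun n c)) (of_real (test_point j)) / test_freq j =
      c j * M j j + (\<Sum>k<n. c k * Q j k)" if j: "j < n" for j
  proof -
    have y: "\<bar>test_point j\<bar> < 1" "complex_of_real (test_point j) \<in> unit_disk"
      using test_point_bounds[of j] by auto
    have "deriv (dfun (test_fun n c)) (of_real (test_point j)) / test_freq j = (\<Sum>k<n. c k * M j k)"
      using y by (simp add: test_fun_def deriv_dfun_sum deriv_dfun_scaleC deriv_freq_block M_def sum_divide_distrib)
    also have "\<dots> = (\<Sum>k<n. (if k = j then c j * M j j else 0) + c k * Q j k)"
      by (intro sum.cong) (auto simp: Q_def)
    also have "\<dots> = c j * M j j + (\<Sum>k<n. c k * Q j k)"
      using j by (simp add: sum.distrib)
    finally show ?thesis .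
  qed
  have "(\<Sum>j<n. (cmod (deriv (dfun (test_fun n c)) (of_real (test_point j))))\<^sup>2 / (real (test_freq j))\<^sup>2) =
      (\<Sum>j<n. (cmod (c j * M j j + (\<Sum>k<n. c k * Q j k)))\<^sup>2)"
    by (intro sum.cong refl) (simp add: norm_divide power_divide flip: eq)
  moreover have "(\<Sum>j<n. (cmod (c j))\<^sup>2) / 1024 \<le> (\<Sum>j<n. (cmod (c j * M j j + (\<Sum>k<n. c k * Q j k)))\<^sup>2)"
    using M0 diag row col by (intro dominant_diagonal_lower_bound) (auto simp: Q_def)
  ultimately show ?thesis by simp
qed

section \<open>Test disks in the cusp\<close>

context cusp_symbol
begin

definition test_disk :: "nat \<Rightarrow> complex set" where
  "test_disk k = ball (of_real (test_point k)) (\<delta> (10 * Suc k) / (2 * real (test_freq k)))"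

lemma test_disk_subset: "test_disk k \<subseteq> cusp_domain \<delta>"
  using ball_subset_cusp_domain[OF half, of "10 * Suc k"]
  by (simp only: test_disk_def half_power_test_freq test_point_def) simp

text \<open>As \<open>\<delta>\<close> is at most 1/2, the radius is at most 1/(4 N) with N =
  \<open>test_freq k\<close>. On the disk 1 - Re z therefore lies between 3/4 and 5/4 of 1/N, and
  distinct frequencies differ by far more than a factor 5/3.\<close>

lemma disjoint_test_disk: "disjoint_family test_disk"
proof -
  have re: "3 / (4 * real (test_freq k)) < 1 - Re z \<and> 1 - Re z < 5 / (4 * real (test_freq k))" if "z \<in> test_disk k" for z k
  proof -
    let ?N = "real (test_freq k)"
    have "\<bar>Re z - test_point k\<bar> < \<delta> (10 * Suc k) / (2 * ?N)"
      using that abs_Re_le_cmod[of "z - of_real (test_point k)"]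
      by (simp add: test_disk_def dist_norm norm_minus_commute)
    also have "\<dots> \<le> (1 / 2) / (2 * ?N)"
      using half by (intro divide_right_mono) auto
    finally have "\<bar>Re z - (1 - 1 / ?N)\<bar> < 1 / (4 * ?N)" by (simp add: test_point_def)
    moreover have "3 / (4 * ?N) = 1 / ?N - 1 / (4 * ?N)" "5 / (4 * ?N) = 1 / ?N + 1 / (4 * ?N)"
      using test_freq_pos[of k] by (auto simp: field_simps)
    ultimately show ?thesis by linarith
  qed
  have "test_disk j \<inter> test_disk k = {}" if jk: "j < k" for j k
  proof (rule ccontr)
    assume "test_disk j \<inter> test_disk k \<noteq> {}"
    then obtain z where "z \<in> test_disk j" "z \<in> test_disk k" by blast
    then have "3 / (4 * real (test_freq j)) < 5 / (4 * real (test_freq k))" using re by (meson less_trans)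
    then have "3 * real (test_freq k) < 5 * real (test_freq j)"
      using test_freq_pos[of j] test_freq_pos[of k] by (simp add: field_simps)
    then have "3 * test_freq k < 5 * test_freq j" by linarith
    then show False using test_freq_gap[OF jk] by linarith
  qed
  then show ?thesis unfolding disjoint_family_on_def by (metis Int_commute linorder_neqE_nat)
qed

lemma test_disk_energy:
  "ennreal (pi * (\<delta> (10 * Suc k) / (2 * real (test_freq k)))\<^sup>2 * (cmod (deriv (dfun f) (of_real (test_point k))))\<^sup>2)
    \<le> (\<integral>\<^sup>+w\<in>test_disk k. ennreal ((cmod (deriv (dfun f) w))\<^sup>2) \<partial>lborel)"
  unfolding test_disk_def
proof (rule holomorphic_area_submean_value[where R = "1 / test_freq k"])
  let ?N = "real (test_freq k)"
  \<comment> \<open>The disk of radius 1/N about 1 - 1/N touches the unit circle from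
    inside.\<close>
  have "ball (complex_of_real (test_point k)) (1 / ?N) \<subseteq> unit_disk"
  proof
    fix w assume "w \<in> ball (complex_of_real (test_point k)) (1 / ?N)"
    then have "cmod (w - of_real (test_point k)) < 1 / ?N" by (simp add: dist_norm norm_minus_commute)
    then have "cmod w < cmod (complex_of_real (test_point k)) + 1 / ?N"
      using norm_triangle_sub[of w "of_real (test_point k)"] by linarith
    also have "cmod (complex_of_real (test_point k)) = 1 - 1 / ?N"
      using test_point_bounds[of k] by (simp only: norm_of_real) (simp add: test_point_def)
    finally show "w \<in> unit_disk" by simp
  qed
  then show "deriv (dfun f) holomorphic_on ball (of_real (test_point k)) (1 / ?N)"
    by (rule holomorphic_on_subset[OF dirichlet_setD(2)[OF dfun]])
  show "0 < \<delta> (10 * Suc k) / (2 * ?N)" using pos test_freq_pos by simp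
  have "\<delta> (10 * Suc k) < 2" using half[of "10 * Suc k"] by linarith
  then show "\<delta> (10 * Suc k) / (2 * ?N) < 1 / ?N" using test_freq_pos[of k] by (simp add: field_simps)
qed

text \<open>Adds the submean value bounds over the \<open>n\<close> disjoint disks. By monotonicity
  every width is at least the last one, \<open>\<delta> (10 * n)\<close>. The constant is pi/4 from
  the squared radii times 1/1024 from the matrix estimate.\<close>

lemma energy_test_fun_ge:
  "pi / 4096 * (\<delta> (10 * n))\<^sup>2 * (\<Sum>k<n. (cmod (c k))\<^sup>2) \<le> dirichlet_energy (cusp_domain \<delta>) (dfun (test_fun n c))"
proof -
  let ?f = "test_fun n c"
  let ?g = "\<lambda>z. ennreal ((cmod (deriv (dfun ?f) z))\<^sup>2)"
  let ?v = "\<lambda>k. (cmod (deriv (dfun ?f) (of_real (test_point k))))\<^sup>2"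
  have sub: "test_disk k \<subseteq> unit_disk" for k using test_disk_subset domain_subset by blast
  have mg: "(\<lambda>z. ?g z * indicator (test_disk k) z) \<in> borel_measurable lborel" for k
    using borel_measurable_norm_power2_on[OF dirichlet_setD(3)[OF dfun] _ _ sub] by (simp add: test_disk_def)
  have "pi / 4096 * (\<delta> (10 * n))\<^sup>2 * (\<Sum>k<n. (cmod (c k))\<^sup>2) =
      pi / 4 * (\<delta> (10 * n))\<^sup>2 * ((\<Sum>k<n. (cmod (c k))\<^sup>2) / 1024)" by simp
  also have "\<dots> \<le> pi / 4 * (\<delta> (10 * n))\<^sup>2 * (\<Sum>k<n. ?v k / (real (test_freq k))\<^sup>2)"
    by (intro mult_left_mono deriv_test_fun_lower_bound) auto
  also have "\<dots> = (\<Sum>k<n. pi * (\<delta> (10 * n) / (2 * real (test_freq k)))\<^sup>2 * ?v k)"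
    by (simp add: sum_distrib_left power_divide power_mult_distrib)
  also have "\<dots> \<le> (\<Sum>k<n. pi * (\<delta> (10 * Suc k) / (2 * real (test_freq k)))\<^sup>2 * ?v k)"
  proof (rule sum_mono)
    fix k assume k: "k \<in> {..<n}"
    have "\<delta> (10 * n) \<le> \<delta> (10 * Suc k)" by (rule decseqD[OF dec]) (use k in auto)
    then have "\<delta> (10 * n) / (2 * real (test_freq k)) \<le> \<delta> (10 * Suc k) / (2 * real (test_freq k))"
      by (rule divide_right_mono) simp
    then have "(\<delta> (10 * n) / (2 * real (test_freq k)))\<^sup>2 \<le> (\<delta> (10 * Suc k) / (2 * real (test_freq k)))\<^sup>2"
      by (rule power_mono) (use pos[of "10 * n"] in simp)
    then show "pi * (\<delta> (10 * n) / (2 * real (test_freq k)))\<^sup>2 * ?v k \<le>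
        pi * (\<delta> (10 * Suc k) / (2 * real (test_freq k)))\<^sup>2 * ?v k"
      by (intro mult_right_mono mult_left_mono) auto
  qed
  finally have "ennreal (pi / 4096 * (\<delta> (10 * n))\<^sup>2 * (\<Sum>k<n. (cmod (c k))\<^sup>2)) \<le>
      ennreal (\<Sum>k<n. pi * (\<delta> (10 * Suc k) / (2 * real (test_freq k)))\<^sup>2 * ?v k)"
    by (rule ennreal_leI)
  also have "\<dots> = (\<Sum>k<n. ennreal (pi * (\<delta> (10 * Suc k) / (2 * real (test_freq k)))\<^sup>2 * ?v k))"
    by (intro sum_ennreal[symmetric]) auto
  also have "\<dots> \<le> (\<Sum>k<n. \<integral>\<^sup>+z\<in>test_disk k. ?g z \<partial>lborel)"
    by (intro sum_mono test_disk_energy)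
  also have "\<dots> = (\<integral>\<^sup>+z. (\<Sum>k<n. ?g z * indicator (test_disk k) z) \<partial>lborel)"
    using mg by (intro nn_integral_sum[symmetric])
  also have "\<dots> \<le> (\<integral>\<^sup>+z\<in>cusp_domain \<delta>. ?g z \<partial>lborel)"
  proof (intro nn_integral_mono)
    fix z
    have "(\<Sum>k<n. ?g z * indicator (test_disk k) z) = ?g z * indicator (\<Union>k<n. test_disk k) z"
      using disjoint_test_disk
      by (subst indicator_UN_disjoint) (auto simp: sum_distrib_left disjoint_family_on_def)
    also have "\<dots> \<le> ?g z * indicator (cusp_domain \<delta>) z"
      using test_disk_subset by (intro mult_left_mono) (auto split: split_indicator)
    finally show "(\<Sum>k<n. ?g z * indicator (test_disk k) z) \<le> ?g z * indicator (cusp_domain \<delta>) z" .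
  qed
  also have "\<dots> = ennreal (dirichlet_energy (cusp_domain \<delta>) (dfun ?f))"
    by (rule ennreal_dirichlet_energy[symmetric, OF dfun]) (use domain_subset in auto)
  finally show ?thesis using dirichlet_energy_nonneg by (simp add: ennreal_le_iff)
qed

lemma norm_compose_test_fun:
  "(\<delta> (10 * n))\<^sup>2 / 4096 * (\<Sum>k<n. (cmod (c k))\<^sup>2) \<le> (norm (dirichlet_compose \<phi> (test_fun n c)))\<^sup>2"
proof -
  have "(\<delta> (10 * n))\<^sup>2 / 4096 * (\<Sum>k<n. (cmod (c k))\<^sup>2) \<le>
      dirichlet_energy (cusp_domain \<delta>) (dfun (test_fun n c)) / pi"
    using energy_test_fun_ge[of n c] by (simp add: field_simps)
  also have "\<dots> \<le> (norm (dirichlet_compose \<phi> (test_fun n c)))\<^sup>2"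
    by (simp add: norm_dirichlet_compose_power2 image)
  finally show ?thesis .
qed

text \<open>The number 100 is a round one with 2 / 100^2 <= 1/4096, where the 2 comes from
  \<open>norm_test_fun_le\<close>.\<close>

lemma norm_compose_test_fun_ge:
  "\<delta> (10 * n) / 100 * norm (test_fun n c) \<le> norm (dirichlet_compose \<phi> (test_fun n c))"
proof (rule power2_le_imp_le)
  let ?S = "\<Sum>k<n. (cmod (c k))\<^sup>2"
  have S: "0 \<le> ?S" by (intro sum_nonneg) auto
  have "(\<delta> (10 * n) / 100 * norm (test_fun n c))\<^sup>2 = (\<delta> (10 * n))\<^sup>2 / 10000 * (norm (test_fun n c))\<^sup>2"
    by (simp add: power_mult_distrib power_divide)
  also have "\<dots> \<le> (\<delta> (10 * n))\<^sup>2 / 10000 * (2 * ?S)"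
    by (intro mult_left_mono norm_test_fun_le) auto
  also have "\<dots> \<le> (\<delta> (10 * n))\<^sup>2 / 4096 * ?S"
    using S by (simp add: field_simps mult_right_mono)
  also have "\<dots> \<le> (norm (dirichlet_compose \<phi> (test_fun n c)))\<^sup>2" by (rule norm_compose_test_fun)
  finally show "(\<delta> (10 * n) / 100 * norm (test_fun n c))\<^sup>2 \<le> (norm (dirichlet_compose \<phi> (test_fun n c)))\<^sup>2" .
qed simp

text \<open>Linear independence of the blocks, read off from the lower bound: a nonzero coefficient
  forces a nonzero image.\<close>

lemma test_fun_nonzero:
  assumes "k < n" "c k \<noteq> 0"
  shows "test_fun n c \<noteq> 0"
proof
  assume "test_fun n c = 0"
  moreover have "dirichlet_compose \<phi> 0 = 0"
    using dirichlet_compose_scaleC[of 0 0] by simp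
  ultimately have "(\<delta> (10 * n))\<^sup>2 / 4096 * (\<Sum>k<n. (cmod (c k))\<^sup>2) \<le> 0"
    using norm_compose_test_fun[of n c] by simp
  moreover have "0 < (\<Sum>k<n. (cmod (c k))\<^sup>2)"
    using assms by (intro sum_pos2[of _ k]) auto
  moreover have "0 < (\<delta> (10 * n))\<^sup>2 / 4096" using pos[of "10 * n"] by simp
  ultimately show False by (metis mult_pos_pos not_le)
qed

end

section \<open>Approximation numbers\<close>


text \<open>The \<open>n\<close> vectors \<open>R (f k)\<close> lie in a space of dimension less
  than \<open>n\<close>, so a nontrivial relation holds among them; by linearity it is a combination
  killed by \<open>R\<close>.\<close>

lemma low_rank_kernel:
  fixes f :: "nat \<Rightarrow> dirichlet"
  assumes lin: "clinear_op R" and rank: "op_rank R < enat n"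
  shows "\<exists>c. (\<exists>k<n. c k \<noteq> 0) \<and> R (\<Sum>k<n. scaleC (c k) (f k)) = 0"
proof -
  interpret R: Vector_Spaces.linear scaleC scaleC R by (rule lin)
  obtain B where B: "finite B" "range R \<subseteq> dirichlet.span B" and dim: "dirichlet.dim (range R) < n"
    using rank by (auto simp: op_rank_def split: if_splits)
  obtain B' where B': "B' \<subseteq> range R" "dirichlet.independent B'" "range R \<subseteq> dirichlet.span B'"
      "card B' = dirichlet.dim (range R)"
    by (rule dirichlet.basis_exists)
  have finB': "finite B'"
    using dirichlet.independent_span_bound[OF B(1) B'(2)] B'(1) B(2) by blast
  have Rsum: "R (\<Sum>k<n. scaleC (c k) (f k)) = (\<Sum>k<n. scaleC (c k) (R (f k)))" for c
    by (simp add: R.sum R.scale)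
  show ?thesis
  \<comment> \<open>Linear dependence concerns the set of vectors, in which repetitions disappear.
    If two indices share an image, the coefficients 1 and -1 give the relation directly.\<close>
  proof (cases "inj_on (\<lambda>k. R (f k)) {..<n}")
    case False
    then obtain i j where ij: "i < n" "j < n" "i \<noteq> j" "R (f i) = R (f j)"
      by (auto simp: inj_on_def)
    define c where "c = (\<lambda>k. if k = i then 1 else if k = j then - 1 else (0::complex))"
    have "(\<Sum>k<n. scaleC (c k) (R (f k))) =
        (\<Sum>k<n. (if k = i then R (f i) else 0) + (if k = j then - R (f j) else 0))"
      using ij(3) by (intro sum.cong) (auto simp: c_def)
    also have "\<dots> = 0" using ij by (simp add: sum.distrib)
    finally have "R (\<Sum>k<n. scaleC (c k) (f k)) = 0" by (simp only: Rsum)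
    moreover have "c i \<noteq> 0" by (simp add: c_def)
    ultimately show ?thesis using ij(1) by blast
  next
    case True
    let ?S = "(\<lambda>k. R (f k)) ` {..<n}"
    have "dirichlet.dependent ?S"
    proof (rule ccontr)
      assume "dirichlet.independent ?S"
      moreover have "?S \<subseteq> dirichlet.span B'" using B'(3) by blast
      ultimately have "card ?S \<le> card B'"
        using dirichlet.independent_span_bound[OF finB'] by blast
      then show False using True dim B'(4) by (simp add: card_image)
    qed
    then obtain u where u: "\<exists>v\<in>?S. u v \<noteq> 0" "(\<Sum>v\<in>?S. scaleC (u v) v) = 0"
      by (subst (asm) dirichlet.dependent_finite) auto
    have "(\<Sum>k<n. scaleC (u (R (f k))) (R (f k))) = 0"
      using u(2) by (subst (asm) sum.reindex[OF True]) (simp add: o_def)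
    then have "R (\<Sum>k<n. scaleC (u (R (f k))) (f k)) = 0" by (simp only: Rsum)
    moreover have "\<exists>k<n. u (R (f k)) \<noteq> 0" using u(1) by auto
    ultimately show ?thesis by (intro exI[of _ "\<lambda>k. u (R (f k))"]) simp
  qed
qed

lemma bounded_op_zero: "bounded_op (\<lambda>_. 0)"
  unfolding bounded_op_def Vector_Spaces.linear_iff
  by (auto intro: dirichlet.vector_space_axioms bounded_linear_zero)

text \<open>Provides a competitor in \<open>approx_number n\<close> for n >= 1, so that the infimum
  is over a nonempty set.\<close>

lemma op_rank_zero: "op_rank (\<lambda>_. 0) = 0"
proof -
  have "range (\<lambda>_::dirichlet. 0 :: dirichlet) = {0}" by auto
  moreover have "dirichlet.dim {0} = 0"
    using dirichlet.dim_le_card[of "{0}" "{}"] by simp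
  ultimately show ?thesis by (auto simp: op_rank_def zero_enat_def intro!: exI[of _ "{}"])
qed

lemma (in cusp_symbol) approx_number_ge:
  assumes "n \<ge> 1"
  shows "\<delta> (10 * n) / 100 \<le> approx_number n (dirichlet_compose \<phi>)"
  unfolding approx_number_def
proof (rule cInf_greatest)
  have "op_rank (\<lambda>_. 0) < enat n" using assms by (simp add: op_rank_zero zero_enat_def)
  then show "{onorm (\<lambda>f. dirichlet_compose \<phi> f - R f) |R. bounded_op R \<and> op_rank R < enat n} \<noteq> {}"
    using bounded_op_zero by blast
next
  fix x assume "x \<in> {onorm (\<lambda>f. dirichlet_compose \<phi> f - R f) |R. bounded_op R \<and> op_rank R < enat n}"
  then obtain R where x: "x = onorm (\<lambda>f. dirichlet_compose \<phi> f - R f)"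
    and R: "bounded_op R" "op_rank R < enat n" by blast
  obtain c k where c: "k < n" "c k \<noteq> 0" "R (test_fun n c) = 0"
    using low_rank_kernel[of R n "\<lambda>k. freq_block (test_freq k)"] R
    by (auto simp: bounded_op_def test_fun_def)
  let ?g = "test_fun n c"
  have bl: "bounded_linear (\<lambda>f. dirichlet_compose \<phi> f - R f)"
    using R(1) bounded_op_dirichlet_compose by (auto simp: bounded_op_def intro: bounded_linear_sub)
  have "\<delta> (10 * n) / 100 * norm ?g \<le> norm (dirichlet_compose \<phi> ?g - R ?g)"
    using norm_compose_test_fun_ge[of n c] by (simp add: c(3))
  also have "\<dots> \<le> x * norm ?g"
    unfolding x by (rule onorm[OF bl])
  finally show "\<delta> (10 * n) / 100 \<le> x"
    using test_fun_nonzero[of k n c] c(1,2) by simp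
qed

section \<open>Choice of the symbol and of the widths\<close>

lemma cusp_symbol_exists:
  assumes "decseq \<delta>" and pos: "\<And>s. 0 < \<delta> s" and half: "\<And>s. \<delta> s \<le> 1 / 2" and "\<delta> \<longlonglongrightarrow> 0"
  obtains \<phi> where "cusp_symbol \<phi> \<delta>"
proof -
  let ?S = "cusp_domain \<delta>"
  have sub: "?S \<subseteq> unit_disk" using half by (rule cusp_domain_subset_unit_disk)
  have "?S \<noteq> {}" using zero_in_cusp_box[of \<delta> 1, OF pos] by (auto simp: cusp_domain_def)
  moreover have "?S \<noteq> UNIV"
  proof
    assume "?S = UNIV"
    then have "(1::complex) \<in> unit_disk" using sub by blast
    then show False by simp
  qed
  moreover have "simply_connected ?S"
    using pos by (intro starlike_imp_simply_connected starlike_cusp_domain)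
  ultimately obtain f g where g: "g holomorphic_on ball 0 1"
    and fg: "\<forall>z\<in>?S. f z \<in> ball 0 1 \<and> g (f z) = z" "\<forall>z\<in>ball 0 1. g z \<in> ?S \<and> f (g z) = z"
    using Riemann_mapping_theorem[of ?S] open_cusp_domain[of \<delta>] by blast
  have im: "g ` unit_disk = ?S" using fg by (auto simp: image_iff) (metis mem_ball_0)
  have "inj_on g unit_disk" using fg(2) by (intro inj_on_inverseI[of _ f]) auto
  then have "cusp_symbol g \<delta>"
    using g im sub assms by unfold_locales auto
  then show ?thesis by (rule that)
qed

text \<open>Tail suprema. The widths of the cusp have to decrease, while the given sequence need
  not. The absolute value takes care of the index 0, where the theorem leaves the sign open.\<close>

lemma null_sequence_monotone_majorant:
  fixes \<epsilon> :: "nat \<Rightarrow> real"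
  assumes "\<epsilon> \<longlonglongrightarrow> 0"
  obtains E where "decseq E" "E \<longlonglongrightarrow> 0" "\<And>n. \<bar>\<epsilon> n\<bar> \<le> E n"
proof -
  define E where "E = (\<lambda>k. SUP m\<in>{k..}. \<bar>\<epsilon> m\<bar>)"
  obtain B where "\<And>n. norm (\<epsilon> n) \<le> B"
    using convergent_imp_Bseq[of \<epsilon>] assms by (auto simp: convergent_def Bseq_def)
  then have bdd: "bdd_above ((\<lambda>m. \<bar>\<epsilon> m\<bar>) ` {k..})" for k
    by (intro bdd_aboveI2[of _ _ B]) auto
  have ge: "\<bar>\<epsilon> n\<bar> \<le> E k" if "k \<le> n" for n k
    unfolding E_def using that by (intro cSUP_upper bdd) auto
  have "decseq E"
    unfolding decseq_def E_def by (intro allI impI cSUP_subset_mono bdd) auto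
  moreover have "E \<longlonglongrightarrow> 0"
  proof (rule LIMSEQ_I)
    fix r :: real assume r: "0 < r"
    then obtain N where N: "\<And>n. n \<ge> N \<Longrightarrow> norm (\<epsilon> n - 0) < r / 2"
      using LIMSEQ_D[OF assms, of "r / 2"] by auto
    have "norm (E n - 0) < r" if "n \<ge> N" for n
    proof -
      have "E n \<le> r / 2"
        unfolding E_def using N that by (intro cSUP_least) (auto simp: less_imp_le)
      moreover have "0 \<le> E n" using ge[of n n] by linarith
      ultimately show ?thesis using r by simp
    qed
    then show "\<exists>N. \<forall>n\<ge>N. norm (E n - 0) < r" by blast
  qed
  ultimately show ?thesis using ge by (intro that) auto
qed

theorem theorem1p2:
  fixes \<epsilon> :: "nat \<Rightarrow> real"
  assumes "\<And>n. n \<ge> 1 \<Longrightarrow> \<epsilon> n > 0"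
    and "\<epsilon> \<longlonglongrightarrow> 0"
  shows "\<exists>\<phi> C. \<phi> holomorphic_on unit_disk \<and> \<phi> ` unit_disk \<subseteq> unit_disk \<and>
    composition_op \<phi> C \<and> compact_op C \<and>
    liminf (\<lambda>n. ereal (approx_number n C / \<epsilon> n)) > 0"
proof -
  obtain E where E: "decseq E" "E \<longlonglongrightarrow> 0" "\<And>n. \<bar>\<epsilon> n\<bar> \<le> E n"
    using null_sequence_monotone_majorant[OF assms(2)] by blast
  have Epos: "0 < E n" for n
  proof -
    \<comment> \<open>The detour through \<open>Suc n\<close> is due to \<open>\<epsilon> 0\<close>,
      which is not assumed positive.\<close>
    have "0 < \<epsilon> (Suc n)" by (rule assms(1)) simp
    also have "\<dots> \<le> E (Suc n)" using E(3)[of "Suc n"] by linarith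
    also have "\<dots> \<le> E n" using E(1) by (simp add: decseq_def)
    finally show ?thesis .
  qed
  \<comment> \<open>Constant on blocks of ten indices, so that \<open>\<delta> (10 * n)\<close> is
    \<open>E n / (2 * E 0)\<close>; the denominator keeps all widths at most 1/2.\<close>
  define \<delta> where "\<delta> = (\<lambda>s. E (s div 10) / (2 * E 0))"
  have "decseq \<delta>"
    unfolding decseq_def \<delta>_def
    using Epos[of 0] by (intro allI impI divide_right_mono decseqD[OF E(1)] div_le_mono) auto
  moreover have "0 < \<delta> s" for s using Epos by (simp add: \<delta>_def)
  moreover have "\<delta> s \<le> 1 / 2" for s
    using decseqD[OF E(1), of 0 "s div 10"] Epos[of 0] by (simp add: \<delta>_def field_simps)
  moreover have "\<delta> \<longlonglongrightarrow> 0"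
  proof -
    have "filterlim (\<lambda>s::nat. s div 10) at_top at_top"
      unfolding filterlim_at_top
    proof
      fix Z :: nat
      have "Z \<le> s div 10" if "s \<ge> 10 * Z" for s using that by simp
      then show "\<forall>\<^sub>F s in sequentially. Z \<le> s div 10"
        unfolding eventually_sequentially by blast
    qed
    then have "(\<lambda>s. E (s div 10) / (2 * E 0)) \<longlonglongrightarrow> 0 / (2 * E 0)"
      using Epos[of 0] by (intro tendsto_intros filterlim_compose[OF E(2)]) auto
    then show ?thesis by (simp add: \<delta>_def)
  qed
  ultimately obtain \<phi> where "cusp_symbol \<phi> \<delta>" by (rule cusp_symbol_exists)
  then interpret cusp_symbol \<phi> \<delta> .
  let ?C = "dirichlet_compose \<phi>"
  \<comment> \<open>The constant collects the 100 of \<open>approx_number_ge\<close> and the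
    denominator \<open>2 * E 0\<close> of \<open>\<delta>\<close>.\<close>
  have "1 / (200 * E 0) \<le> approx_number n ?C / \<epsilon> n" if n: "n \<ge> 1" for n
  proof -
    have e: "0 < \<epsilon> n" "\<epsilon> n \<le> E n" using assms(1)[OF n] E(3)[of n] by linarith+
    have "1 / (200 * E 0) * \<epsilon> n \<le> 1 / (200 * E 0) * E n"
      using e Epos[of 0] by (intro mult_left_mono) auto
    also have "\<dots> = \<delta> (10 * n) / 100" by (simp add: \<delta>_def)
    also have "\<dots> \<le> approx_number n ?C" by (rule approx_number_ge[OF n])
    finally show ?thesis using e by (simp add: le_divide_eq)
  qed
  then have "ereal (1 / (200 * E 0)) \<le> liminf (\<lambda>n. ereal (approx_number n ?C / \<epsilon> n))"
    by (intro Liminf_bounded eventually_sequentiallyI[of 1]) simp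
  moreover have "0 < ereal (1 / (200 * E 0))" using Epos[of 0] by simp
  ultimately have "0 < liminf (\<lambda>n. ereal (approx_number n ?C / \<epsilon> n))" by (rule less_le_trans[rotated])
  then show ?thesis
    using hol maps composition_op_dirichlet_compose compact_op_dirichlet_compose by blast
qed

end
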